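(* Let $\mathbb{K}$ be a field, let $n\ge 1$, let $\lambda_1,\dots,\lambda_n\in\mathbb{K}$ be pairwise distinct, and let $J=J_{\lambda_1}\oplus\cdots\oplus J_{\lambda_n}$, where $J_{\lambda_i}=\bigoplus_{j=1}^{\ell_i}k^{(i)}_jJ_{\lambda_i,r^{(i)}_j}$ with $\ell_i\ge 1$, positive integers $k^{(i)}_j$, and positive integers $r^{(i)}_1>\cdots>r^{(i)}_{\ell_i}$. Let $R$ be the polynomial ring in the coordinates on the space on which $J$ acts, let $I_J\subseteq R$ be the ideal generated by the $2\times 2$ minors of $(J\boldsymbol{x}\mid\boldsymbol{x})$, and for $1\le i\le n$, $1\le j\le \ell_i$ let $R_i$, $\mathfrak{q}_{\lambda_i,j}\subseteq R_i$ and $\mathfrak{p}_i\subseteq R$ be as defined in the context. Then $$I_J=\bigcap_{i=1}^n\ \bigcap_{j=1}^{\ell_i}\left(\langle\mathfrak{q}_{\lambda_i,j}\rangle+\mathfrak{p}_i\right)$$ is an irredundant primary decomposition of $I_J$, where $\langle\mathfrak{q}_{\lambda_i,j}\rangle$ is the ideal of $R$ generated by $\mathfrak{q}_{\lambda_i,j}$. Furthermore, for each $i\in\{1,\dots,n\}$ and $j\in\{1,\dots,\ell_i\}$, the Hilbert polynomials satisfy $$H_{R/(\langle\mathfrak{q}_{\lambda_i,j}\rangle+\mathfrak{p}_i)}(t)=H_{R_i/\mathfrak{q}_{\lambda_i,j}}(t)=r^{(i)}_j\binom{t+k^{(i)}_1+\cdots+k^{(i)}_j-1}{t}.$$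
   Context: $J_{\lambda,r}$ denotes the $r\times r$ Jordan block with $\lambda$ on the diagonal and $1$ on the superdiagonal; $kJ_{\lambda,r}$ is the direct sum (block diagonal matrix) of $k$ copies of $J_{\lambda,r}$. For each $i$, let $\xi_i=\sum_{j}k^{(i)}_jr^{(i)}_j$ be the size of $J_{\lambda_i}$. The rows of $J_{\lambda_i}$ are indexed by $\Lambda^{(i)}=\{(a,b,c): 1\le a\le \ell_i,\ 1\le b\le k^{(i)}_a,\ 1\le c\le r^{(i)}_a\}$ in lexicographically increasing order: $(a,b,c)$ is the $c$-th row of the $b$-th copy of the Jordan block $J_{\lambda_i,r^{(i)}_a}$. Let $R_i=\mathbb{K}[x^{(i)}(a,b,c) : (a,b,c)\in\Lambda^{(i)}]$ (a polynomial ring in $\xi_i$ variables, standard graded), and let $\boldsymbol{x}_i$ be the column vector of its variables in the given order. Let $R$ be the polynomial ring over $\mathbb{K}$ in all the variables $x^{(i)}(a,b,c)$, $1\le i\le n$ (standard graded), and let $\boldsymbol{x}$ be the column vector obtained by stacking $\boldsymbol{x}_1,\dots,\boldsymbol{x}_n$. $(M\boldsymbol{x}\mid\boldsymbol{x})$ denotes the two-column matrix with columns $M\boldsymbol{x}$ and $\boldsymbol{x}$. $\mathfrak{p}_i$ is the ideal of $R$ generated by all variables $x^{(i')}(a,b,c)$ with $i'\neq i$. $\mathfrak{q}_{\lambda_i,j}$ is the ideal of $R_i$ generated by the $2\times2$ minors of $(J_{\lambda_i}\boldsymbol{x}_i\mid\boldsymbol{x}_i)$ together with all variables $x^{(i)}(a,b,c)$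 such that either $a\le j$ and $c\ge r^{(i)}_j+1$, or $a>j$. The binomial coefficient $\binom{t+K-1}{t}$ is read as the polynomial $\binom{t+K-1}{K-1}$ in $t$. *)

theory Defs
  imports
    "HOL-Library.Poly_Mapping"
    "HOL-Algebra.Embedded_Algebras"
    "HOL-Algebra.QuotRing"
    "Jordan_Normal_Form.Jordan_Normal_Form"
    "Jordan_Normal_Form.DL_Submatrix"
begin

section \<open>Polynomial rings in finitely many variables\<close>

text \<open>
  A polynomial is a finitely supported map from monomials to coefficients, and a monomial is a
  finitely supported map from variables to exponents. The type \<open>('v, 'k) mpol\<close> involves every
  variable in \<open>'v\<close>; \<open>poly_ring V\<close> is the polynomial ring in the variables of \<open>V\<close> only, so that for
  \<open>V \<subseteq> W\<close> the ring \<open>poly_ring V\<close> is literally a subring of \<open>poly_ring W\<close>.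
\<close>

type_synonym ('v, 'k) mpol = "('v \<Rightarrow>\<^sub>0 nat) \<Rightarrow>\<^sub>0 'k"

definition const :: "'k::zero \<Rightarrow> ('v, 'k) mpol" where
  "const c = Poly_Mapping.single 0 c"

definition var :: "'v \<Rightarrow> ('v, 'k::zero_neq_one) mpol" where
  "var v = Poly_Mapping.single (Poly_Mapping.single v 1) 1"

definition mdeg :: "('v \<Rightarrow>\<^sub>0 nat) \<Rightarrow> nat" where
  "mdeg m = (\<Sum>v\<in>Poly_Mapping.keys m. Poly_Mapping.lookup m v)"

definition poly_ring :: "'v set \<Rightarrow> ('v, 'k::field) mpol ring" where
  "poly_ring V =
    \<lparr>carrier = {p. \<forall>m\<in>Poly_Mapping.keys p. Poly_Mapping.keys m \<subseteq> V},
     monoid.mult = (*), one = 1, zero = 0, add = (+)\<rparr>"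

definition homogeneous_part :: "'v set \<Rightarrow> nat \<Rightarrow> ('v, 'k::field) mpol set" where
  "homogeneous_part V t =
    {p \<in> carrier (poly_ring V). \<forall>m\<in>Poly_Mapping.keys p. mdeg m = t}"

lemma poly_ring_cring: "cring (poly_ring V :: ('v, 'k::field) mpol ring)"
proof -
  let ?R = "poly_ring V :: ('v, 'k) mpol ring"
  have mult: "p * q \<in> carrier ?R" if "p \<in> carrier ?R" "q \<in> carrier ?R" for p q
  proof -
    have "Poly_Mapping.keys m \<subseteq> V" if m: "m \<in> Poly_Mapping.keys (p * q)" for m
    proof -
      from m Poly_Mapping.keys_mult[of p q] obtain a b
        where "m = a + b" "a \<in> Poly_Mapping.keys p" "b \<in> Poly_Mapping.keys q" by blast
      then show ?thesis
        using \<open>p \<in> carrier ?R\<close> \<open>q \<in> carrier ?R\<close> Poly_Mapping.keys_add[of a b]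
        by (fastforce simp: poly_ring_def)
    qed
    then show ?thesis by (simp add: poly_ring_def)
  qed
  have add: "p + q \<in> carrier ?R" if "p \<in> carrier ?R" "q \<in> carrier ?R" for p q
    using that Poly_Mapping.keys_add[of p q] by (fastforce simp: poly_ring_def)
  have neg: "\<exists>q\<in>carrier ?R. p + q = 0" if "p \<in> carrier ?R" for p
    using that by (intro bexI[of _ "- p"]) (auto simp: poly_ring_def)
  have mem: "0 \<in> carrier ?R" "1 \<in> carrier ?R"
    by (auto simp: poly_ring_def)
  have ops: "x \<otimes>\<^bsub>?R\<^esub> y = x * y" "x \<oplus>\<^bsub>?R\<^esub> y = x + y" "\<one>\<^bsub>?R\<^esub> = 1" "\<zero>\<^bsub>?R\<^esub> = 0" for x y
    by (simp_all add: poly_ring_def)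
  have "abelian_group ?R"
    by (rule abelian_groupI) (simp_all only: ops add mem neg add_ac add_0_left add_0_right)
  moreover have "comm_monoid ?R"
    by (rule comm_monoidI) (simp_all only: ops mult mem mult_ac mult_1_left mult_1_right)
  ultimately show ?thesis
    by (rule cringI) (simp only: ops distrib_right)
qed

section \<open>Primary decomposition\<close>

definition radical :: "('a, 'm) ring_scheme \<Rightarrow> 'a set \<Rightarrow> 'a set" where
  "radical R I = {a \<in> carrier R. \<exists>m::nat. a [^]\<^bsub>R\<^esub> m \<in> I}"

definition primary_ideal :: "'a set \<Rightarrow> ('a, 'm) ring_scheme \<Rightarrow> bool" where
  "primary_ideal Q R \<longleftrightarrow>
    ideal Q R \<and> Q \<noteq> carrier R \<and>
    (\<forall>a\<in>carrier R. \<forall>b\<in>carrier R. a \<otimes>\<^bsub>R\<^esub> b \<in> Q \<longrightarrow> a \<in> Q \<or> b \<in> radical R Q)"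

text \<open>
  Irredundant means that no component contains the intersection of the others and that the radicals
  of the components are pairwise distinct. The empty intersection of ideals is the whole ring.
\<close>

definition irredundant_primary_decomposition ::
    "('a, 'm) ring_scheme \<Rightarrow> 'a set \<Rightarrow> 's set \<Rightarrow> ('s \<Rightarrow> 'a set) \<Rightarrow> bool" where
  "irredundant_primary_decomposition R I S Q \<longleftrightarrow>
    finite S \<and>
    (\<forall>s\<in>S. primary_ideal (Q s) R) \<and>
    I = carrier R \<inter> (\<Inter>s\<in>S. Q s) \<and>
    (\<forall>s\<in>S. \<not> carrier R \<inter> (\<Inter>u\<in>S - {s}. Q u) \<subseteq> Q s) \<and>
    inj_on (\<lambda>s. radical R (Q s)) S"

section \<open>Hilbert polynomials\<close>

text \<open>
  For a homogeneous ideal \<open>I\<close>, the graded piece \<open>(poly_ring V / I)\<^sub>t\<close> is the image of the degree \<open>t\<close>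
  part of \<open>poly_ring V\<close>. Its dimension is taken over the image of the field of constants in the
  quotient ring.
\<close>

definition quot_scalars :: "'v set \<Rightarrow> ('v, 'k::field) mpol set \<Rightarrow> ('v, 'k) mpol set set" where
  "quot_scalars V I = (\<lambda>c. I +>\<^bsub>poly_ring V\<^esub> const c) ` UNIV"

definition quot_part :: "'v set \<Rightarrow> ('v, 'k::field) mpol set \<Rightarrow> nat \<Rightarrow> ('v, 'k) mpol set set" where
  "quot_part V I t = (\<lambda>p. I +>\<^bsub>poly_ring V\<^esub> p) ` homogeneous_part V t"

definition has_hilbert_polynomial ::
    "'v set \<Rightarrow> ('v, 'k::field) mpol set \<Rightarrow> rat poly \<Rightarrow> bool" where
  "has_hilbert_polynomial V I P \<longleftrightarrow>
    (\<exists>t0. \<forall>t\<ge>t0. \<exists>d. ring.dimension (poly_ring V Quot I) d (quot_scalars V I) (quot_part V I t) \<and>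
                   poly P (of_nat t) = of_nat d)"

lemma const_in_poly_ring: "const c \<in> carrier (poly_ring V)"
  by (simp add: const_def poly_ring_def)

lemma const_ring_hom:
  "const \<in> Ring.ring_hom \<lparr>carrier = UNIV, monoid.mult = (*), one = 1, zero = 0, add = (+)\<rparr>
     (poly_ring V :: ('v, 'k::field) mpol ring)"
  by (auto intro!: ring_hom_memI simp: const_def poly_ring_def single_add mult_single)

lemma quot_scalars_subfield:
  fixes I :: "('v, 'k::field) mpol set"
  assumes "ideal I (poly_ring V)" "I \<noteq> carrier (poly_ring V)"
  shows "subfield (quot_scalars V I) (poly_ring V Quot I)"
proof -
  let ?F = "\<lparr>carrier = UNIV :: 'k set, monoid.mult = (*), one = 1, zero = 0, add = (+)\<rparr>"
  let ?R = "poly_ring V :: ('v, 'k) mpol ring"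
  interpret ideal I ?R by fact
  have neg: "\<exists>y. x + y = 0" for x :: 'k
    by (rule exI[of _ "- x"]) simp
  have "abelian_group ?F"
    by (rule abelian_groupI) (simp_all add: add_ac neg)
  moreover have "comm_monoid ?F"
    by (rule comm_monoidI) (simp_all add: mult_ac)
  ultimately interpret F: cring ?F
    by (rule cringI) (simp add: distrib_right)
  have inv: "\<exists>y. x * y = 1" if "x \<noteq> 0" for x :: 'k
    using that by (intro exI[of _ "inverse x"]) simp
  have F: "field ?F"
    by (rule F.cring_fieldI2) (use inv in auto)
  interpret Q: ring "?R Quot I" by (rule quotient_is_ring)
  interpret h: ring_hom_ring ?F "?R Quot I" "\<lambda>c. I +>\<^bsub>?R\<^esub> const c"
    using ring_hom_trans[OF const_ring_hom rcos_ring_hom]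
    by (intro ring_hom_ringI2 F.ring_axioms Q.ring_axioms) (simp add: comp_def)
  have "\<one>\<^bsub>?R Quot I\<^esub> \<noteq> \<zero>\<^bsub>?R Quot I\<^esub>"
    using assms one_imp_carrier a_rcos_const
    by (metis FactRing_def a_rcos_self monoid.select_convs(2) one_closed ring.simps(1))
  from h.img_is_subfield[OF field.carrier_is_subfield[OF F] this] show ?thesis
    by (simp add: quot_scalars_def)
qed

lemma has_hilbert_polynomial_unique:
  assumes "ideal I (poly_ring V)" "I \<noteq> carrier (poly_ring V)"
    and "has_hilbert_polynomial V I P" "has_hilbert_polynomial V I P'"
  shows "P = P'"
proof -
  interpret ideal I "poly_ring V" by fact
  interpret Q: ring "poly_ring V Quot I" by (rule quotient_is_ring)
  from assms(3,4) obtain t1 t2 where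
    t1: "\<And>t. t \<ge> t1 \<Longrightarrow> \<exists>d. Q.dimension d (quot_scalars V I) (quot_part V I t) \<and>
           poly P (of_nat t) = of_nat d" and
    t2: "\<And>t. t \<ge> t2 \<Longrightarrow> \<exists>d. Q.dimension d (quot_scalars V I) (quot_part V I t) \<and>
           poly P' (of_nat t) = of_nat d"
    unfolding has_hilbert_polynomial_def by blast
  have "poly (P - P') (of_nat t) = 0" if "t \<ge> max t1 t2" for t
    using t1[of t] t2[of t] that Q.dimension_is_inj[OF quot_scalars_subfield[OF assms(1,2)]] by auto
  then have "of_nat ` {max t1 t2..} \<subseteq> {x. poly (P - P') x = 0}" by auto
  moreover have "infinite (of_nat ` {max t1 t2..} :: rat set)"
    by (simp add: finite_image_iff inj_on_def infinite_Ici)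
  ultimately have "infinite {x. poly (P - P') x = 0}" using finite_subset by blast
  then show ?thesis using poly_roots_finite[of "P - P'"] by auto
qed

text \<open>The polynomial \<open>(t + K - 1 choose K - 1) = (t + 1) \<dots> (t + K - 1) / (K - 1)!\<close> in \<open>t\<close>, for \<open>K \<ge> 1\<close>.\<close>

definition binom_poly :: "nat \<Rightarrow> rat poly" where
  "binom_poly K = smult (1 / fact (K - 1)) (\<Prod>m=1..<K. [:of_nat m, 1:])"

lemma poly_binom_poly:
  assumes "K \<ge> 1"
  shows "poly (binom_poly K) (of_nat t) = of_nat ((t + K - 1) choose t)"
proof -
  obtain s where K: "K = Suc s" using assms by (cases K) auto
  have "(\<Prod>m=1..<Suc s. of_nat t + of_nat m) * fact t = (fact (t + s) :: rat)"
  proof (induction s)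
    case (Suc s)
    have "(\<Prod>m=1..<Suc (Suc s). of_nat t + of_nat m :: rat) * fact t =
        (\<Prod>m=1..<Suc s. of_nat t + of_nat m) * fact t * of_nat (t + Suc s)"
      by (simp only: prod.atLeastLessThan_Suc le_add1 plus_1_eq_Suc Suc_le_mono le0 of_nat_add mult_ac One_nat_def)
    also have "\<dots> = fact (t + Suc s)"
      unfolding Suc.IH by simp
    finally show ?case .
  qed simp
  then have "(\<Prod>m=1..<Suc s. of_nat t + of_nat m) / fact s = (fact (t + s) / (fact t * fact s) :: rat)"
    by (simp add: field_simps)
  also have "\<dots> = of_nat ((t + s) choose t)"
    by (simp add: binomial_fact)
  finally show ?thesis
    by (simp add: binom_poly_def K poly_prod add.commute del: prod.op_ivl_Suc)
qed

section \<open>Eigenschemes of Jordan matrices\<close>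

definition minors :: "nat \<Rightarrow> 'a::comm_ring_1 mat \<Rightarrow> 'a set" where
  "minors s A = {det (submatrix A I J) | I J.
     I \<subseteq> {..<dim_row A} \<and> J \<subseteq> {..<dim_col A} \<and> card I = s \<and> card J = s}"

definition two_column :: "'k::field mat \<Rightarrow> 'v list \<Rightarrow> ('v, 'k) mpol mat" where
  "two_column M vs =
    (let x = vec_of_list (map var vs) in mat_of_cols (length vs) [map_mat const M *\<^sub>v x, x])"

text \<open>
  Throughout, the Jordan matrix is given by \<open>n\<close> and functions \<open>lam\<close>, \<open>l\<close>, \<open>k\<close>, \<open>r\<close> of 1-based
  indices: for the eigenvalue \<open>lam i\<close> there are \<open>k i j\<close> blocks of size \<open>r i j\<close>, for \<open>j\<close> from 1 to
  \<open>l i\<close>. The tuple \<open>(i, a, b, c)\<close> stands for the variable \<open>x\<^sup>(\<^sup>i\<^sup>)(a, b, c)\<close>; the lists below are in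
  lexicographic order.
\<close>

type_synonym idx = "nat \<times> nat \<times> nat \<times> nat"

definition Lam_list ::
    "(nat \<Rightarrow> nat) \<Rightarrow> (nat \<Rightarrow> nat \<Rightarrow> nat) \<Rightarrow> (nat \<Rightarrow> nat \<Rightarrow> nat) \<Rightarrow> nat \<Rightarrow> idx list" where
  "Lam_list l k r i =
    [(i, a, b, c). a \<leftarrow> [1..<l i + 1], b \<leftarrow> [1..<k i a + 1], c \<leftarrow> [1..<r i a + 1]]"

definition all_list ::
    "nat \<Rightarrow> (nat \<Rightarrow> nat) \<Rightarrow> (nat \<Rightarrow> nat \<Rightarrow> nat) \<Rightarrow> (nat \<Rightarrow> nat \<Rightarrow> nat) \<Rightarrow> idx list" where
  "all_list n l k r = concat (map (Lam_list l k r) [1..<n + 1])"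

abbreviation Lam ::
    "(nat \<Rightarrow> nat) \<Rightarrow> (nat \<Rightarrow> nat \<Rightarrow> nat) \<Rightarrow> (nat \<Rightarrow> nat \<Rightarrow> nat) \<Rightarrow> nat \<Rightarrow> idx set" where
  "Lam l k r i \<equiv> set (Lam_list l k r i)"

abbreviation all_vars ::
    "nat \<Rightarrow> (nat \<Rightarrow> nat) \<Rightarrow> (nat \<Rightarrow> nat \<Rightarrow> nat) \<Rightarrow> (nat \<Rightarrow> nat \<Rightarrow> nat) \<Rightarrow> idx set" where
  "all_vars n l k r \<equiv> set (all_list n l k r)"

lemma Lam_iff:
  "(i', a, b, c) \<in> Lam l k r i \<longleftrightarrow>
    i' = i \<and> 1 \<le> a \<and> a \<le> l i \<and> 1 \<le> b \<and> b \<le> k i a \<and> 1 \<le> c \<and> c \<le> r i a"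
  by (auto simp: Lam_list_def image_iff simp del: upt_Suc)

lemma all_vars_eq: "all_vars n l k r = (\<Union>i\<in>{1..n}. Lam l k r i)"
  unfolding all_list_def set_concat set_map set_upt by (simp add: atLeastLessThanSuc_atLeastAtMost)

definition J_eig ::
    "(nat \<Rightarrow> 'k::field) \<Rightarrow> (nat \<Rightarrow> nat) \<Rightarrow> (nat \<Rightarrow> nat \<Rightarrow> nat) \<Rightarrow> (nat \<Rightarrow> nat \<Rightarrow> nat) \<Rightarrow> nat \<Rightarrow> 'k mat"
  where
  "J_eig lam l k r i =
    jordan_matrix [(r i a, lam i). a \<leftarrow> [1..<l i + 1], b \<leftarrow> [1..<k i a + 1]]"

definition J_mat ::
    "nat \<Rightarrow> (nat \<Rightarrow> 'k::field) \<Rightarrow> (nat \<Rightarrow> nat) \<Rightarrow> (nat \<Rightarrow> nat \<Rightarrow> nat) \<Rightarrow> (nat \<Rightarrow> nat \<Rightarrow> nat) \<Rightarrow> 'k mat"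
  where
  "J_mat n lam l k r = diag_block_mat (map (J_eig lam l k r) [1..<n + 1])"

definition I_J ::
    "nat \<Rightarrow> (nat \<Rightarrow> 'k::field) \<Rightarrow> (nat \<Rightarrow> nat) \<Rightarrow> (nat \<Rightarrow> nat \<Rightarrow> nat) \<Rightarrow> (nat \<Rightarrow> nat \<Rightarrow> nat)
      \<Rightarrow> (idx, 'k) mpol set" where
  "I_J n lam l k r =
    Idl\<^bsub>poly_ring (all_vars n l k r)\<^esub> minors 2 (two_column (J_mat n lam l k r) (all_list n l k r))"

definition p_ideal ::
    "nat \<Rightarrow> (nat \<Rightarrow> nat) \<Rightarrow> (nat \<Rightarrow> nat \<Rightarrow> nat) \<Rightarrow> (nat \<Rightarrow> nat \<Rightarrow> nat) \<Rightarrow> nat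
      \<Rightarrow> (idx, 'k::field) mpol set" where
  "p_ideal n l k r i =
    Idl\<^bsub>poly_ring (all_vars n l k r)\<^esub>
      {var (i', a, b, c) | i' a b c. (i', a, b, c) \<in> all_vars n l k r \<and> i' \<noteq> i}"

definition q_ideal ::
    "(nat \<Rightarrow> 'k::field) \<Rightarrow> (nat \<Rightarrow> nat) \<Rightarrow> (nat \<Rightarrow> nat \<Rightarrow> nat) \<Rightarrow> (nat \<Rightarrow> nat \<Rightarrow> nat) \<Rightarrow> nat \<Rightarrow> nat
      \<Rightarrow> (idx, 'k) mpol set" where
  "q_ideal lam l k r i j =
    Idl\<^bsub>poly_ring (Lam l k r i)\<^esub>
      (minors 2 (two_column (J_eig lam l k r i) (Lam_list l k r i)) \<union>
       {var (i, a, b, c) | a b c.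
          (i, a, b, c) \<in> Lam l k r i \<and> (a \<le> j \<and> c \<ge> r i j + 1 \<or> a > j)})"

definition component ::
    "nat \<Rightarrow> (nat \<Rightarrow> 'k::field) \<Rightarrow> (nat \<Rightarrow> nat) \<Rightarrow> (nat \<Rightarrow> nat \<Rightarrow> nat) \<Rightarrow> (nat \<Rightarrow> nat \<Rightarrow> nat)
      \<Rightarrow> nat \<Rightarrow> nat \<Rightarrow> (idx, 'k) mpol set" where
  "component n lam l k r i j =
    (Idl\<^bsub>poly_ring (all_vars n l k r)\<^esub> q_ideal lam l k r i j)
      <+>\<^bsub>poly_ring (all_vars n l k r)\<^esub> p_ideal n l k r i"

end

theory Submission
  imports
    Defs
    "HOL-Library.Product_Lexorder" (* the library has mpol as an integral domain only for linearly ordered variables *)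
begin

text \<open>
  Fix an eigenvalue \<open>lam i\<close> and a block index \<open>j\<close>. Substituting \<open>u\<^sub>a\<^sub>b \<epsilon>\<^sup>c\<^sup>-\<^sup>1\<close> for the variable
  \<open>x(a, b, c)\<close> with \<open>a \<le> j\<close>, and \<open>0\<close> for every other variable, makes \<open>J x\<close> and \<open>(lam i + \<epsilon>) x\<close>
  agree modulo \<open>\<epsilon>\<^sup>r\<close>, \<open>r = r i j\<close>, so the polynomials whose image is divisible by \<open>\<epsilon>\<^sup>r\<close> form an
  ideal containing the minors. Since \<open>\<epsilon>\<close> is prime in the target ring, this ideal is primary, and
  its radical consists of the polynomials whose image is divisible by \<open>\<epsilon>\<close>.

  A monomial is sent to \<open>u\<^sup>\<alpha> \<epsilon>\<^sup>e\<close>, where the shape \<open>\<alpha>\<close> records the pairs \<open>(a, b)\<close> and the excess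
  \<open>e\<close> is the sum of all \<open>c - 1\<close>. Modulo the minors belonging to one eigenvalue, any unit of excess
  can be moved from one variable to another. Hence monomials of equal shape and excess are
  congruent, and a monomial vanishes as soon as its excess reaches the size of the shortest block
  it involves. Products of variables of two different eigenvalues lie in \<open>I_J\<close> because
  \<open>lam i - lam i'\<close> is invertible. These congruences determine \<open>I_J\<close> and its components by linear
  conditions on the coefficients. The witness for irredundancy is \<open>x(j, 1, r i j)\<close>, and the Hilbert
  function in degree \<open>t \<ge> 1\<close> counts the pairs \<open>(\<alpha>, e)\<close> with \<open>|\<alpha>| = t\<close> and \<open>e < r\<close>.
\<close>

section \<open>Monomials and the substitution by powers of \<epsilon>\<close>

abbreviation mon :: "('v \<Rightarrow>\<^sub>0 nat) \<Rightarrow> ('v, 'k::zero_neq_one) mpol" where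
  "mon m \<equiv> Poly_Mapping.single m 1"

abbreviation vmon :: "'v \<Rightarrow> ('v \<Rightarrow>\<^sub>0 nat)" where
  "vmon v \<equiv> Poly_Mapping.single v (Suc 0)"

section \<open>Exponent vectors and induction over monomials\<close>

lemma var_neq_0 [simp]: "(var v :: ('v, 'k::field) mpol) \<noteq> 0"
  by (simp add: var_def flip: keys_eq_empty)

lemma mon_vmon_add: "(mon (vmon v + m) :: ('v, 'k::field) mpol) = var v * mon m"
  by (simp add: var_def mult_single)

lemma sum_singles_keys:
  "(\<Sum>k\<in>Poly_Mapping.keys p. Poly_Mapping.single k (Poly_Mapping.lookup p k)) = p"
  by (rule poly_mapping_eqI) (auto simp: lookup_sum lookup_single when_def in_keys_iff)

lemma keys_add_nat: "Poly_Mapping.keys (m + m' :: 'v \<Rightarrow>\<^sub>0 nat) = Poly_Mapping.keys m \<union> Poly_Mapping.keys m'"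
  by (auto simp: in_keys_iff lookup_add)

lemma keys_diff_nat: "Poly_Mapping.keys (m - m' :: 'v \<Rightarrow>\<^sub>0 nat) \<subseteq> Poly_Mapping.keys m"
  by (auto simp: in_keys_iff lookup_minus)

lemma nonzero_obtain_key:
  assumes "(m :: 'v \<Rightarrow>\<^sub>0 'b::zero) \<noteq> 0"
  obtains v where "v \<in> Poly_Mapping.keys m"
  using assms keys_eq_empty[of m] by (metis ex_in_conv)

lemma remove_vmon:
  assumes "v \<in> Poly_Mapping.keys (m :: 'v \<Rightarrow>\<^sub>0 nat)"
  obtains m' where "m = vmon v + m'"
proof
  show "m = vmon v + (m - vmon v)"
    using assms by (intro poly_mapping_eqI) (auto simp: lookup_add lookup_minus lookup_single when_def in_keys_iff)
qed

lemma mdeg_0 [simp]: "mdeg 0 = 0"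
  by (simp add: mdeg_def)

lemma mdeg_vmon [simp]: "mdeg (vmon v) = 1"
  by (simp add: mdeg_def)

lemma mdeg_add [simp]: "mdeg (m + m') = mdeg m + mdeg m'"
  unfolding mdeg_def by (rule setsum_keys_plus_distrib) auto

lemma mdeg_eq_0_iff [simp]: "mdeg m = 0 \<longleftrightarrow> m = 0"
  by (auto simp: mdeg_def in_keys_iff intro!: poly_mapping_eqI)

lemma monomial_induct [case_names zero add]:
  fixes m :: "'v \<Rightarrow>\<^sub>0 nat"
  assumes "P 0" "\<And>v m. P m \<Longrightarrow> P (vmon v + m)"
  shows "P m"
proof (induction "mdeg m" arbitrary: m)
  case 0
  then show ?case using assms(1) by simp
next
  case (Suc d)
  then have "m \<noteq> 0" by auto
  then obtain v where "v \<in> Poly_Mapping.keys m" by (rule nonzero_obtain_key)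
  then obtain m' where "m = vmon v + m'" by (rule remove_vmon)
  with Suc show ?case using assms(2) by simp
qed

section \<open>Shape and excess of a monomial\<close>

definition base :: "idx \<Rightarrow> idx" where
  "base = (\<lambda>(i, a, b, c). (i, a, b, 1))"

definition off :: "idx \<Rightarrow> nat" where
  "off = (\<lambda>(i, a, b, c). c - 1)"

text \<open>\<open>base v\<close> plays the role of u_ab: the first variable of each Jordan block
  doubles as the new variable, so that shapes are again monomials over \<open>idx\<close>.\<close>

definition shape :: "(idx \<Rightarrow>\<^sub>0 nat) \<Rightarrow> (idx \<Rightarrow>\<^sub>0 nat)" where
  "shape m = (\<Sum>v\<in>Poly_Mapping.keys m. Poly_Mapping.single (base v) (Poly_Mapping.lookup m v))"

definition excess :: "(idx \<Rightarrow>\<^sub>0 nat) \<Rightarrow> nat" where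
  "excess m = (\<Sum>v\<in>Poly_Mapping.keys m. Poly_Mapping.lookup m v * off v)"

lemma shape_0 [simp]: "shape 0 = 0" and excess_0 [simp]: "excess 0 = 0"
  by (simp_all add: shape_def excess_def)

lemma shape_vmon [simp]: "shape (vmon v) = vmon (base v)"
  and excess_vmon [simp]: "excess (vmon v) = off v"
  by (simp_all add: shape_def excess_def)

lemma shape_add [simp]: "shape (m + m') = shape m + shape m'"
  unfolding shape_def by (rule setsum_keys_plus_distrib) (auto simp: single_add)

lemma excess_add [simp]: "excess (m + m') = excess m + excess m'"
  unfolding excess_def by (rule setsum_keys_plus_distrib) (auto simp: distrib_right)

lemma mdeg_shape [simp]: "mdeg (shape m) = mdeg m"
  by (induction m rule: monomial_induct) auto

lemma keys_shape: "Poly_Mapping.keys (shape m) = base ` Poly_Mapping.keys m"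
  by (induction m rule: monomial_induct) (auto simp: keys_add_nat)

text \<open>The outer \<open>poly\<close> is the ring of polynomials in \<epsilon>, and
  \<open>U\<close> is the set of variables that are not sent to 0.\<close>

definition eps_map :: "idx set \<Rightarrow> (idx, 'k::field) mpol \<Rightarrow> (idx, 'k) mpol poly" where
  "eps_map U p = (\<Sum>m\<in>Poly_Mapping.keys p.
     if Poly_Mapping.keys m \<subseteq> U then monom (Poly_Mapping.single (shape m) (Poly_Mapping.lookup p m)) (excess m) else 0)"

lemma eps_map_0 [simp]: "eps_map U 0 = 0"
  by (simp add: eps_map_def)

lemma eps_map_single:
  "eps_map U (Poly_Mapping.single m c) =
    (if Poly_Mapping.keys m \<subseteq> U then monom (Poly_Mapping.single (shape m) c) (excess m) else 0)"
  by (simp add: eps_map_def)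

lemma eps_map_add: "eps_map U (p + q) = eps_map U p + eps_map U q"
  unfolding eps_map_def by (rule setsum_keys_plus_distrib) (auto simp: add_monom single_add)

lemma eps_map_sum: "eps_map U (sum f A) = (\<Sum>a\<in>A. eps_map U (f a))"
  by (induction A rule: infinite_finite_induct) (auto simp: eps_map_add)

text \<open>On monomials this holds because shape and excess are additive and exponents cannot
  cancel, so a product survives exactly when both factors do. Bilinearity does the rest.\<close>

lemma eps_map_mult: "eps_map U (p * q) = eps_map U p * eps_map U q"
proof -
  have single: "eps_map U (Poly_Mapping.single m c * Poly_Mapping.single m' c') =
      eps_map U (Poly_Mapping.single m c) * eps_map U (Poly_Mapping.single m' c')"
    for m m' and c c' :: 'a
    by (auto simp: mult_single eps_map_single keys_add_nat mult_monom)
  have "eps_map U (p * q) = eps_map U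
      ((\<Sum>m\<in>Poly_Mapping.keys p. Poly_Mapping.single m (Poly_Mapping.lookup p m)) *
       (\<Sum>m\<in>Poly_Mapping.keys q. Poly_Mapping.single m (Poly_Mapping.lookup q m)))"
    by (simp add: sum_singles_keys)
  also have "\<dots> = eps_map U (\<Sum>m\<in>Poly_Mapping.keys p. Poly_Mapping.single m (Poly_Mapping.lookup p m)) *
       eps_map U (\<Sum>m\<in>Poly_Mapping.keys q. Poly_Mapping.single m (Poly_Mapping.lookup q m))"
    unfolding sum_product eps_map_sum single ..
  finally show ?thesis by (simp add: sum_singles_keys)
qed

lemma eps_map_diff: "eps_map U (p - q) = eps_map U p - eps_map U q"
  using eps_map_add[of U "p - q" q] by simp

lemma eps_map_var:
  "eps_map U (var v) = (if v \<in> U then monom (var (base v)) (off v) else 0)"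
  by (simp add: var_def eps_map_single)

lemma eps_map_1 [simp]: "eps_map U 1 = 1"
  by (simp add: eps_map_single monom_0 one_pCons flip: single_one)

text \<open>This turns divisibility by a power of \<epsilon> into linear conditions: one coefficient
  sum for each class of monomials with common shape and excess.\<close>

lemma lookup_coeff_eps_map:
  "Poly_Mapping.lookup (coeff (eps_map U p) e) s =
    (\<Sum>m | m \<in> Poly_Mapping.keys p \<and> Poly_Mapping.keys m \<subseteq> U \<and> shape m = s \<and> excess m = e.
      Poly_Mapping.lookup p m)"
  unfolding eps_map_def coeff_sum lookup_sum
  by (intro sum.mono_neutral_cong_right) (auto simp: lookup_single when_def)

section \<open>Ideals of polynomial rings\<close>

lemma poly_ring_simps [simp]:
  "x \<otimes>\<^bsub>poly_ring V\<^esub> y = x * y" "x \<oplus>\<^bsub>poly_ring V\<^esub> y = x + y"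
  "\<one>\<^bsub>poly_ring V\<^esub> = 1" "\<zero>\<^bsub>poly_ring V\<^esub> = 0"
  by (simp_all add: poly_ring_def)

lemma mem_poly_ring_iff: "p \<in> carrier (poly_ring V) \<longleftrightarrow> (\<forall>m\<in>Poly_Mapping.keys p. Poly_Mapping.keys m \<subseteq> V)"
  by (simp add: poly_ring_def)

lemma poly_ring_closed:
  fixes p q :: "('v, 'k::field) mpol"
  shows "(0 :: ('v, 'k) mpol) \<in> carrier (poly_ring V)" "(1 :: ('v, 'k) mpol) \<in> carrier (poly_ring V)"
  "p \<in> carrier (poly_ring V) \<Longrightarrow> q \<in> carrier (poly_ring V) \<Longrightarrow> p + q \<in> carrier (poly_ring V)"
  "p \<in> carrier (poly_ring V) \<Longrightarrow> q \<in> carrier (poly_ring V) \<Longrightarrow> p * q \<in> carrier (poly_ring V)"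
  "p \<in> carrier (poly_ring V) \<Longrightarrow> q \<in> carrier (poly_ring V) \<Longrightarrow> p - q \<in> carrier (poly_ring V)"
  "p \<in> carrier (poly_ring V) \<Longrightarrow> - p \<in> carrier (poly_ring V)"
proof -
  interpret cring "poly_ring V :: ('v, 'k) mpol ring" by (rule poly_ring_cring)
  show "(0 :: ('v, 'k) mpol) \<in> carrier (poly_ring V)" "(1 :: ('v, 'k) mpol) \<in> carrier (poly_ring V)"
    using zero_closed one_closed by simp_all
  show "p + q \<in> carrier (poly_ring V)" "p * q \<in> carrier (poly_ring V)"
    if "p \<in> carrier (poly_ring V)" "q \<in> carrier (poly_ring V)" for p q :: "('v, 'k) mpol"
    using a_closed[OF that] m_closed[OF that] by simp_all
  show neg: "- p \<in> carrier (poly_ring V)" if "p \<in> carrier (poly_ring V)" for p :: "('v, 'k) mpol"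
    using that by (simp add: mem_poly_ring_iff)
  show "p - q \<in> carrier (poly_ring V)"
    if "p \<in> carrier (poly_ring V)" "q \<in> carrier (poly_ring V)" for p q :: "('v, 'k) mpol"
    using a_closed[OF that(1) neg[OF that(2)]] by simp
qed

lemma mon_in_poly_ring: "Poly_Mapping.keys m \<subseteq> V \<Longrightarrow> mon m \<in> carrier (poly_ring V)"
  and var_in_poly_ring: "v \<in> V \<Longrightarrow> var v \<in> carrier (poly_ring V)"
  by (simp_all add: mem_poly_ring_iff var_def)

lemma poly_ring_mono: "V \<subseteq> W \<Longrightarrow> carrier (poly_ring V) \<subseteq> carrier (poly_ring W)"
  by (fastforce simp: mem_poly_ring_iff)

lemma poly_ring_nat_pow: "p [^]\<^bsub>poly_ring V\<^esub> (n::nat) = p ^ n"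
proof -
  interpret cring "poly_ring V :: ('a, 'b) mpol ring" by (rule poly_ring_cring)
  show ?thesis by (induction n) (simp_all add: mult.commute)
qed

lemma poly_ideal_closed:
  assumes "ideal I (poly_ring V)"
  shows poly_ideal_subset: "I \<subseteq> carrier (poly_ring V)"
    and poly_ideal_0: "0 \<in> I"
    and poly_ideal_add: "x \<in> I \<Longrightarrow> y \<in> I \<Longrightarrow> x + y \<in> I"
    and poly_ideal_mult: "x \<in> I \<Longrightarrow> q \<in> carrier (poly_ring V) \<Longrightarrow> q * x \<in> I"
    and poly_ideal_mult_right: "x \<in> I \<Longrightarrow> q \<in> carrier (poly_ring V) \<Longrightarrow> x * q \<in> I"
    and poly_ideal_uminus: "x \<in> I \<Longrightarrow> - x \<in> I"
    and poly_ideal_diff: "x \<in> I \<Longrightarrow> y \<in> I \<Longrightarrow> x - y \<in> I"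
proof -
  interpret ideal I "poly_ring V" by fact
  show "I \<subseteq> carrier (poly_ring V)" by (rule a_subset)
  show "0 \<in> I" using additive_subgroup.zero_closed[OF is_additive_subgroup] by simp
  show add: "x + y \<in> I" if "x \<in> I" "y \<in> I" for x y
    using additive_subgroup.a_closed[OF is_additive_subgroup that] by simp
  show mult: "q * x \<in> I" if "x \<in> I" "q \<in> carrier (poly_ring V)" for x q
    using I_l_closed[OF that] by simp
  show "x * q \<in> I" if "x \<in> I" "q \<in> carrier (poly_ring V)" for x q
    using I_r_closed[OF that] by simp
  have neg: "- x \<in> I" if "x \<in> I" for x
    using mult[OF that, of "- 1"] by (simp add: poly_ring_closed)
  then show "x \<in> I \<Longrightarrow> - x \<in> I" .
  show "x - y \<in> I" if "x \<in> I" "y \<in> I"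
    using add[OF that(1) neg[OF that(2)]] by simp
qed

lemma poly_ideal_sum:
  assumes "ideal I (poly_ring V)" "\<And>a. a \<in> A \<Longrightarrow> f a \<in> I"
  shows "sum f A \<in> I"
  using assms(2) by (induction A rule: infinite_finite_induct)
    (auto simp: poly_ideal_0[OF assms(1)] poly_ideal_add[OF assms(1)])

lemma poly_idealI:
  assumes "I \<subseteq> carrier (poly_ring V)" "0 \<in> I" "\<And>x y. x \<in> I \<Longrightarrow> y \<in> I \<Longrightarrow> x + y \<in> I"
    and mult: "\<And>x q. x \<in> I \<Longrightarrow> q \<in> carrier (poly_ring V) \<Longrightarrow> q * x \<in> I"
  shows "ideal I (poly_ring V)"
proof -
  interpret cring "poly_ring V :: ('a, 'b) mpol ring" by (rule poly_ring_cring)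
  have neg: "\<ominus>\<^bsub>poly_ring V\<^esub> x = - x" if "x \<in> carrier (poly_ring V)" for x :: "('a, 'b) mpol"
    using that by (intro minus_equality) (auto simp: poly_ring_closed)
  have uminus: "- x \<in> I" if "x \<in> I" for x
    using mult[OF that, of "- 1"] by (simp add: poly_ring_closed)
  show ?thesis
  proof (rule idealI)
    show "ring (poly_ring V :: ('a, 'b) mpol ring)" by (rule ring_axioms)
    show "subgroup I (add_monoid (poly_ring V))"
    proof (rule add.subgroupI)
      show "\<ominus>\<^bsub>poly_ring V\<^esub> x \<in> I" if "x \<in> I" for x
        using that assms(1) uminus neg by (metis subsetD)
      show "x \<oplus>\<^bsub>poly_ring V\<^esub> y \<in> I" if "x \<in> I" "y \<in> I" for x y
        using assms(3)[OF that] by simp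
    qed (use assms(1,2) in auto)
    show "q \<otimes>\<^bsub>poly_ring V\<^esub> x \<in> I" "x \<otimes>\<^bsub>poly_ring V\<^esub> q \<in> I"
      if "x \<in> I" "q \<in> carrier (poly_ring V)" for x q
      using mult[OF that] by (simp_all add: mult.commute[of x q])
  qed
qed

lemma const_0 [simp]: "const 0 = 0"
  by (simp add: const_def)

lemma const_sum: "const (sum f A) = (\<Sum>a\<in>A. const (f a))"
  by (induction A rule: infinite_finite_induct) (auto simp: const_def single_add)

text \<open>Grouped by \<open>g\<close>, the terms of a class in \<open>Z\<close> lie in
  \<open>I\<close> one by one. In any other class the coefficients add up to 0, so its terms form a
  combination of differences of congruent monomials.\<close>

lemma mem_ideal_by_classes:
  fixes p :: "('v, 'k::field) mpol"
  assumes I: "ideal I (poly_ring V)"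
    and p: "p \<in> carrier (poly_ring V)"
    and zero: "\<And>m. Poly_Mapping.keys m \<subseteq> V \<Longrightarrow> Z (g m) \<Longrightarrow> mon m \<in> I"
    and eqv: "\<And>m m'. Poly_Mapping.keys m \<subseteq> V \<Longrightarrow> Poly_Mapping.keys m' \<subseteq> V \<Longrightarrow> \<not> Z (g m) \<Longrightarrow>
      g m = g m' \<Longrightarrow> mon m - mon m' \<in> I"
    and cls: "\<And>\<gamma>. \<not> Z \<gamma> \<Longrightarrow> (\<Sum>m | m \<in> Poly_Mapping.keys p \<and> g m = \<gamma>. Poly_Mapping.lookup p m) = 0"
  shows "p \<in> I"
proof -
  let ?C = "\<lambda>\<gamma>. {m. m \<in> Poly_Mapping.keys p \<and> g m = \<gamma>}"
  let ?s = "\<lambda>m. Poly_Mapping.single m (Poly_Mapping.lookup p m)"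
  have keys: "Poly_Mapping.keys m \<subseteq> V" if "m \<in> Poly_Mapping.keys p" for m
    using p that by (auto simp: mem_poly_ring_iff)
  have single: "?s m = const (Poly_Mapping.lookup p m) * mon m" for m
    by (simp add: const_def mult_single)
  have "(\<Sum>m\<in>?C \<gamma>. ?s m) \<in> I" if \<gamma>: "\<gamma> \<in> g ` Poly_Mapping.keys p" for \<gamma>
  proof (cases "Z \<gamma>")
    case True
    have "const (Poly_Mapping.lookup p m) * mon m \<in> I" if "m \<in> ?C \<gamma>" for m
      using that True keys by (intro poly_ideal_mult[OF I] zero const_in_poly_ring) simp_all
    then show ?thesis
      unfolding single by (rule poly_ideal_sum[OF I])
  next
    case False
    from \<gamma> obtain m0 where m0: "m0 \<in> ?C \<gamma>" by auto
    have "(\<Sum>m\<in>?C \<gamma>. const (Poly_Mapping.lookup p m)) = (const (\<Sum>m\<in>?C \<gamma>. Poly_Mapping.lookup p m) :: ('v, 'k) mpol)"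
      by (rule const_sum[symmetric])
    also have "\<dots> = 0" using cls[OF False] by (simp add: const_def)
    \<comment> \<open>Subtracting \<open>mon m0\<close> times the vanishing coefficient sum changes
      nothing and produces the differences.\<close>
    finally have "(\<Sum>m\<in>?C \<gamma>. ?s m) = (\<Sum>m\<in>?C \<gamma>. const (Poly_Mapping.lookup p m) * (mon m - mon m0))"
      unfolding single right_diff_distrib sum_subtractf sum_distrib_right[symmetric] by simp
    also have "\<dots> \<in> I"
    proof (rule poly_ideal_sum[OF I])
      fix m assume m: "m \<in> ?C \<gamma>"
      have "mon m - mon m0 \<in> I"
        using m m0 False keys by (intro eqv) simp_all
      then show "const (Poly_Mapping.lookup p m) * (mon m - mon m0) \<in> I"
        by (rule poly_ideal_mult[OF I]) (rule const_in_poly_ring)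
    qed
    finally show ?thesis .
  qed
  then have "(\<Sum>\<gamma>\<in>g ` Poly_Mapping.keys p. \<Sum>m\<in>?C \<gamma>. ?s m) \<in> I"
    by (rule poly_ideal_sum[OF I])
  then show ?thesis
    using sum.image_gen[of "Poly_Mapping.keys p" ?s g] by (simp add: sum_singles_keys)
qed

section \<open>Shifting the excess of a monomial\<close>

text \<open>Beyond the end of its Jordan block a variable is read as \<open>0\<close>.\<close>

definition tvar :: "(nat \<Rightarrow> nat \<Rightarrow> nat) \<Rightarrow> idx \<Rightarrow> (idx, 'k::field) mpol" where
  "tvar r = (\<lambda>(i, a, b, c). if c \<le> r i a then var (i, a, b, c) else 0)"

text \<open>\<open>pos\<close> and \<open>closed\<close> say that \<open>V\<close> consists of whole
  Jordan blocks. The polynomial in \<open>shift\<close> is a minor for two rows of one eigenvalue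
  after the terms with the eigenvalue cancel, so one argument serves \<open>I_J\<close>,
  \<open>q_ideal\<close> and \<open>component\<close>.\<close>

locale shift_ideal =
  fixes r :: "nat \<Rightarrow> nat \<Rightarrow> nat" and V :: "idx set" and I :: "(idx, 'k::field) mpol set"
  assumes I: "ideal I (poly_ring V)"
    and pos: "(i, a, b, c) \<in> V \<Longrightarrow> 1 \<le> c \<and> c \<le> r i a"
    and closed: "(i, a, b, c) \<in> V \<Longrightarrow> 1 \<le> c' \<Longrightarrow> c' \<le> r i a \<Longrightarrow> (i, a, b, c') \<in> V"
    and shift: "(i, a, b, c) \<in> V \<Longrightarrow> (i, a', b', c') \<in> V \<Longrightarrow>
      tvar r (i, a, b, Suc c) * var (i, a', b', c') - var (i, a, b, c) * tvar r (i, a', b', Suc c') \<in> I"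
begin

lemma base_in: "v \<in> V \<Longrightarrow> base v \<in> V"
proof -
  assume v: "v \<in> V"
  obtain i a b c where v_eq: "v = (i, a, b, c)" by (cases v)
  with v have V: "(i, a, b, c) \<in> V" by simp
  from pos[OF V] have "1 \<le> r i a" by linarith
  from closed[OF V _ this] show ?thesis by (simp add: v_eq base_def)
qed

lemma shape_in: "Poly_Mapping.keys m \<subseteq> V \<Longrightarrow> Poly_Mapping.keys (shape m) \<subseteq> V"
  unfolding keys_shape using base_in by blast

text \<open>Units of excess move one at a time from the second variable to the first. The index
  \<open>c0\<close> certifies that the block meets \<open>V\<close>, while \<open>c\<close> may run
  past the block end, where \<open>tvar\<close> is 0.\<close>

lemma shift_to_base:
  assumes "(i, a, b, c0) \<in> V" "(i, a', b', c') \<in> V" "1 \<le> c"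
  shows "tvar r (i, a, b, c) * var (i, a', b', c') - tvar r (i, a, b, c + (c' - 1)) * var (i, a', b', 1) \<in> I"
  using assms(2,3)
proof (induction c' arbitrary: c)
  case 0
  then show ?case using pos by force
next
  case (Suc c')
  show ?case
  proof (cases "c' = 0")
    case True
    then show ?thesis using poly_ideal_0[OF I] by simp
  next
    case False
    have c': "(i, a', b', c') \<in> V"
      using closed[OF Suc.prems(1), of c'] pos[OF Suc.prems(1)] False by simp
    \<comment> \<open>Within the block this is a shift relation up to sign; past the block end both
      terms are 0.\<close>
    have 1: "tvar r (i, a, b, c) * var (i, a', b', Suc c') - tvar r (i, a, b, Suc c) * var (i, a', b', c') \<in> I"
    proof (cases "c \<le> r i a")
      case True
      then have "(i, a, b, c) \<in> V" using closed[OF assms(1)] Suc.prems by simp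
      from poly_ideal_uminus[OF I shift[OF this c']] show ?thesis
        using pos[OF Suc.prems(1)] True by (simp add: tvar_def)
    next
      case False
      then show ?thesis using poly_ideal_0[OF I] by (simp add: tvar_def)
    qed
    have 2: "tvar r (i, a, b, Suc c) * var (i, a', b', c') - tvar r (i, a, b, Suc c + (c' - 1)) * var (i, a', b', 1) \<in> I"
      using Suc.IH[OF c', of "Suc c"] by simp
    show ?thesis
      using poly_ideal_add[OF I 1 2] False by simp
  qed
qed

text \<open>One chosen block absorbs the excess of every variable of \<open>m\<close>. The single
  eigenvalue is what makes the shift relations applicable.\<close>

lemma shift_mon:
  assumes "(i, a, b, c0) \<in> V" "1 \<le> c" "Poly_Mapping.keys m \<subseteq> V" "fst ` Poly_Mapping.keys m \<subseteq> {i}"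
  shows "tvar r (i, a, b, c) * mon m - tvar r (i, a, b, c + excess m) * mon (shape m) \<in> I"
  using assms(2-)
proof (induction m arbitrary: c rule: monomial_induct)
  case zero
  then show ?case using poly_ideal_0[OF I] by simp
next
  case (add v m)
  have v: "v \<in> V" "fst v = i" and m: "Poly_Mapping.keys m \<subseteq> V" "fst ` Poly_Mapping.keys m \<subseteq> {i}"
    using add.prems by (auto simp: keys_add_nat)
  obtain a' b' c' where v_eq: "v = (i, a', b', c')" using v by (cases v) auto
  have "tvar r (i, a, b, c) * var v - tvar r (i, a, b, c + off v) * var (base v) \<in> I"
    using shift_to_base[OF assms(1), of a' b' c' c] v add.prems by (simp add: v_eq off_def base_def)
  then have 1: "(tvar r (i, a, b, c) * var v - tvar r (i, a, b, c + off v) * var (base v)) * mon m \<in> I"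
    using m by (intro poly_ideal_mult_right[OF I] mon_in_poly_ring)
  have 2: "var (base v) * (tvar r (i, a, b, c + off v) * mon m -
      tvar r (i, a, b, c + off v + excess m) * mon (shape m)) \<in> I"
    using add.IH[of "c + off v"] m add.prems(1) base_in[OF v(1)]
    by (intro poly_ideal_mult[OF I] var_in_poly_ring) auto
  have "tvar r (i, a, b, c) * mon (vmon v + m) -
      tvar r (i, a, b, c + excess (vmon v + m)) * mon (shape (vmon v + m)) =
      (tvar r (i, a, b, c) * var v - tvar r (i, a, b, c + off v) * var (base v)) * mon m +
      var (base v) * (tvar r (i, a, b, c + off v) * mon m -
      tvar r (i, a, b, c + off v + excess m) * mon (shape m))"
    unfolding shape_add excess_add shape_vmon excess_vmon mon_vmon_add
    by (simp add: algebra_simps)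
  then show ?case
    using poly_ideal_add[OF I 1 2] by (rule ssubst)
qed

text \<open>A variable split off from \<open>m\<close> absorbs the excess of the rest, which leaves
  a representative depending only on the block, the shape and the excess. The position is
  \<open>Suc (excess m)\<close> because the excess counts \<open>c - 1\<close>.\<close>

lemma mon_normal_form:
  assumes "Poly_Mapping.keys m \<subseteq> V" "fst ` Poly_Mapping.keys m \<subseteq> {i}" "(i, a, b, c) \<in> Poly_Mapping.keys m"
  shows "mon m - tvar r (i, a, b, Suc (excess m)) * mon (shape m - vmon (i, a, b, 1)) \<in> I"
proof -
  from assms(3) obtain m' where m: "m = vmon (i, a, b, c) + m'" by (rule remove_vmon)
  have V: "(i, a, b, c) \<in> V" and c: "1 \<le> c" "c \<le> r i a" using assms pos by auto
  have "tvar r (i, a, b, c) * mon m' - tvar r (i, a, b, c + excess m') * mon (shape m') \<in> I"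
    using assms(1,2) by (intro shift_mon[OF V c(1)]) (auto simp: m keys_add_nat)
  moreover have "tvar r (i, a, b, c) * mon m' = (mon m :: (idx, 'k) mpol)"
    using c by (simp add: m tvar_def mon_vmon_add del: One_nat_def)
  moreover have "c + excess m' = Suc (excess m)"
    using c by (simp add: m off_def)
  moreover have "shape m' = shape m - vmon (i, a, b, 1)"
    by (simp add: m base_def)
  ultimately show ?thesis by simp
qed

text \<open>Equal shapes involve the same blocks, so both monomials reduce to the normal form at one
  common block.\<close>

lemma mon_cong:
  assumes "Poly_Mapping.keys m \<subseteq> V" "fst ` Poly_Mapping.keys m \<subseteq> {i}"
    and "Poly_Mapping.keys m' \<subseteq> V"
    and "shape m = shape m'" "excess m = excess m'"
  shows "mon m - mon m' \<in> I"
proof (cases "m = 0")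
  case True
  then have "m' = 0" using assms(4) mdeg_shape[of m'] by simp
  with True show ?thesis using poly_ideal_0[OF I] by simp
next
  case False
  then obtain v where v: "v \<in> Poly_Mapping.keys m"
    using keys_eq_empty[of m] by (metis ex_in_conv)
  then obtain a b c where v_eq: "v = (i, a, b, c)" using assms(2) by (cases v) auto
  have keys: "base ` Poly_Mapping.keys m = base ` Poly_Mapping.keys m'"
    using assms(4) by (metis keys_shape)
  then obtain w where w: "w \<in> Poly_Mapping.keys m'" "base w = base v"
    using imageI[OF v, of base] by (auto simp only: image_iff)
  then obtain c' where w_eq: "w = (i, a, b, c')" by (cases w) (auto simp: v_eq base_def)
  \<comment> \<open>\<open>base\<close> keeps the eigenvalue index, so \<open>m'\<close> involves no
    eigenvalue other than \<open>i\<close> either.\<close>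
  have "fst (base u) = fst u" for u by (cases u) (simp add: base_def)
  then have "fst ` Poly_Mapping.keys m' = fst ` base ` Poly_Mapping.keys m'" by (simp add: image_image)
  also have "\<dots> = fst ` Poly_Mapping.keys m"
    using \<open>\<And>u. fst (base u) = fst u\<close> by (simp add: image_image flip: keys)
  finally have "fst ` Poly_Mapping.keys m' \<subseteq> {i}" using assms(2) by simp
  note w' = mon_normal_form[OF assms(3) this w(1)[unfolded w_eq]]
  let ?n = "tvar r (i, a, b, Suc (excess m')) * mon (shape m' - vmon (i, a, b, 1))"
  note v' = mon_normal_form[OF assms(1,2) v[unfolded v_eq], unfolded assms(4,5)]
  have "mon m - mon m' = (mon m - ?n) - (mon m' - ?n)" by (simp only: diff_diff_eq2 diff_add_cancel)
  then show ?thesis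
    using poly_ideal_diff[OF I v' w'] by (rule ssubst)
qed

end

section \<open>Minors of the two-column matrix\<close>

lemma det_2x2:
  fixes A :: "'a::comm_ring_1 mat"
  assumes "A \<in> carrier_mat 2 2"
  shows "det A = A $$ (0, 0) * A $$ (1, 1) - A $$ (0, 1) * A $$ (1, 0)"
proof -
  have "mat_delete A 0 0 \<in> carrier_mat 1 1" "mat_delete A 0 1 \<in> carrier_mat 1 1"
    using assms by (auto simp: mat_delete_def)
  then have "det (mat_delete A 0 0) = A $$ (1, 1)" "det (mat_delete A 0 1) = A $$ (1, 0)"
    using assms by (simp_all add: det_single mat_delete_def)
  then show ?thesis
    using laplace_expansion_row[OF assms, of 0] by (simp add: numeral_2_eq_2 cofactor_def)
qed

text \<open>The matrix-vector product is recorded as a function of the variable instead of its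
  position, so one \<open>f\<close> describes all diagonal blocks and their direct sum.\<close>

definition acts_as :: "'k::field mat \<Rightarrow> 'v list \<Rightarrow> ('v \<Rightarrow> ('v, 'k) mpol) \<Rightarrow> bool" where
  "acts_as M vs f \<longleftrightarrow> dim_row M = length vs \<and> dim_col M = length vs \<and>
    (\<forall>p<length vs. (\<Sum>q<length vs. const (M $$ (p, q)) * var (vs ! q)) = f (vs ! p))"

section \<open>Block diagonal matrices acting on concatenated variable lists\<close>

lemma sum_lessThan_add:
  "(\<Sum>q<n + m. g q) = (\<Sum>q<n. g q) + (\<Sum>q<m. g (n + q :: nat) :: 'a::comm_monoid_add)"
  by (induction m) (simp_all add: add.assoc)

lemma acts_as_four_block:
  assumes "acts_as A vs f" "acts_as B ws f"
  shows "acts_as (four_block_mat A (0\<^sub>m (dim_row A) (dim_col B)) (0\<^sub>m (dim_row B) (dim_col A)) B) (vs @ ws) f"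
proof -
  have dims: "dim_row A = length vs" "dim_col A = length vs" "dim_row B = length ws" "dim_col B = length ws"
    using assms by (auto simp: acts_as_def)
  let ?M = "four_block_mat A (0\<^sub>m (dim_row A) (dim_col B)) (0\<^sub>m (dim_row B) (dim_col A)) B"
  have "(\<Sum>q<length (vs @ ws). const (?M $$ (p, q)) * var ((vs @ ws) ! q)) = f ((vs @ ws) ! p)"
    if p: "p < length (vs @ ws)" for p
  proof (cases "p < length vs")
    case True
    have "(\<Sum>q<length vs. const (A $$ (p, q)) * var (vs ! q)) = f (vs ! p)"
      using assms(1) True by (simp add: acts_as_def)
    with True p show ?thesis
      by (simp add: sum_lessThan_add dims nth_append)
  next
    case False
    have "(\<Sum>q<length ws. const (B $$ (p - length vs, q)) * var (ws ! q)) = f (ws ! (p - length vs))"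
      using assms(2) False p by (auto simp: acts_as_def)
    with False p show ?thesis
      by (simp add: sum_lessThan_add dims nth_append)
  qed
  then show ?thesis by (simp add: acts_as_def dims)
qed

lemma acts_as_diag_block_mat:
  assumes "\<And>x. x \<in> set xs \<Longrightarrow> acts_as (A x) (vs x) f"
  shows "acts_as (diag_block_mat (map A xs)) (concat (map vs xs)) f"
  using assms
proof (induction xs)
  case Nil
  then show ?case by (simp add: acts_as_def)
next
  case (Cons x xs)
  then show ?case
    using acts_as_four_block[of "A x" "vs x" f "diag_block_mat (map A xs)" "concat (map vs xs)"]
    by (simp add: Let_def)
qed

definition jordan_row :: "(nat \<Rightarrow> 'k::field) \<Rightarrow> (nat \<Rightarrow> nat \<Rightarrow> nat) \<Rightarrow> idx \<Rightarrow> (idx, 'k) mpol" where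
  "jordan_row lam r = (\<lambda>(i, a, b, c). const (lam i) * var (i, a, b, c) + tvar r (i, a, b, Suc c))"

lemma acts_as_jordan_block:
  "acts_as (jordan_block (r i a) (lam i)) (map (\<lambda>c. (i, a, b, c)) [1..<r i a + 1]) (jordan_row lam r)"
proof -
  have "(\<Sum>q<r i a. const (jordan_block (r i a) (lam i) $$ (p, q)) * var (i, a, b, Suc q)) =
      jordan_row lam r (i, a, b, Suc p)" if p: "p < r i a" for p
  proof -
    have "(\<Sum>q<r i a. const (jordan_block (r i a) (lam i) $$ (p, q)) * var (i, a, b, Suc q)) =
      (\<Sum>q<r i a. (if q = p then const (lam i) * var (i, a, b, Suc q) else 0) +
         (if q = Suc p then var (i, a, b, Suc q) else 0))"
      using p by (intro sum.cong) (auto simp: const_def)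
    also have "\<dots> = jordan_row lam r (i, a, b, Suc p)"
      unfolding sum.distrib using p by (simp add: jordan_row_def tvar_def)
    finally show ?thesis .
  qed
  then show ?thesis
    by (simp add: acts_as_def nth_append del: upt_Suc)
qed

lemma acts_as_J_eig: "acts_as (J_eig lam l k r i) (Lam_list l k r i) (jordan_row lam r)"
proof -
  \<comment> \<open>One pair \<open>(a, b)\<close> per Jordan block: the matrix and the variable
    list are both rewritten to run over this single list.\<close>
  let ?prs = "concat (map (\<lambda>a. map (Pair a) [1..<k i a + 1]) [1..<l i + 1])"
  have "J_eig lam l k r i = diag_block_mat (map (\<lambda>(a, b). jordan_block (r i a) (lam i)) ?prs)"
    unfolding J_eig_def jordan_matrix_def map_concat map_map comp_def prod.case ..
  moreover have "Lam_list l k r i =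
      concat (map (\<lambda>(a, b). map (\<lambda>c. (i, a, b, c)) [1..<r i a + 1]) ?prs)"
  proof -
    have "concat (map g (concat xss)) = concat (map (\<lambda>xs. concat (map g xs)) xss)"
      for g :: "nat \<times> nat \<Rightarrow> idx list" and xss
      by (induction xss) simp_all
    then show ?thesis unfolding Lam_list_def by (simp add: comp_def del: upt_Suc)
  qed
  ultimately show ?thesis
    using acts_as_jordan_block[of r i _ lam]
    by (auto intro!: acts_as_diag_block_mat simp del: upt_Suc)
qed

lemma acts_as_J_mat: "acts_as (J_mat n lam l k r) (all_list n l k r) (jordan_row lam r)"
  unfolding J_mat_def all_list_def by (intro acts_as_diag_block_mat acts_as_J_eig)

section \<open>Two-row minors of the two-column matrix\<close>

definition minor :: "('v \<Rightarrow> ('v, 'k::field) mpol) \<Rightarrow> 'v \<Rightarrow> 'v \<Rightarrow> ('v, 'k) mpol" where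
  "minor f v w = f v * var w - var v * f w"

lemma two_column_index:
  assumes "acts_as M vs f" "p < length vs"
  shows "two_column M vs $$ (p, 0) = f (vs ! p)" "two_column M vs $$ (p, Suc 0) = var (vs ! p)"
proof -
  show "two_column M vs $$ (p, 0) = f (vs ! p)"
    using assms by (simp add: two_column_def Let_def mat_of_cols_index acts_as_def scalar_prod_def vec_of_list_index atLeast0LessThan)
  show "two_column M vs $$ (p, Suc 0) = var (vs ! p)"
    using assms by (simp add: two_column_def Let_def mat_of_cols_index vec_of_list_index)
qed

lemma two_column_dim: "dim_row (two_column M vs) = length vs" "dim_col (two_column M vs) = 2"
  by (simp_all add: two_column_def Let_def)

lemma det_submatrix_two_column:
  assumes "acts_as M vs f" "p < q" "q < length vs"
  shows "det (submatrix (two_column M vs) {p, q} {0, 1}) = minor f (vs ! p) (vs ! q)"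
proof -
  let ?A = "two_column M vs" let ?S = "submatrix ?A {p, q} {0, 1}"
  have rows: "{i. i < dim_row ?A \<and> i \<in> {p, q}} = {p, q}"
    and cols: "{j. j < dim_col ?A \<and> j \<in> {0, 1}} = {0, 1}"
    using assms by (auto simp: two_column_dim)
  have "?S \<in> carrier_mat 2 2"
    unfolding carrier_mat_def dim_submatrix rows cols mem_Collect_eq using assms(2) by simp
  \<comment> \<open>\<open>submatrix_index_card\<close> addresses an entry by the number of smaller
    selected indices; these sets have 0, 1, 0 and 1 elements.\<close>
  moreover have sets: "{a \<in> {p, q}. a < p} = {}" "{a \<in> {p, q}. a < q} = {p}"
    "{a \<in> {0, 1}. a < (0::nat)} = {}" "{a \<in> {0, 1}. a < (1::nat)} = {0}"
    using assms(2) by auto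
  have "?S $$ (0, 0) = ?A $$ (p, 0)" "?S $$ (0, 1) = ?A $$ (p, 1)"
    "?S $$ (1, 0) = ?A $$ (q, 0)" "?S $$ (1, 1) = ?A $$ (q, 1)"
    using submatrix_index_card[of p ?A 0 "{p, q}" "{0, 1}", unfolded sets]
      submatrix_index_card[of p ?A 1 "{p, q}" "{0, 1}", unfolded sets]
      submatrix_index_card[of q ?A 0 "{p, q}" "{0, 1}", unfolded sets]
      submatrix_index_card[of q ?A 1 "{p, q}" "{0, 1}", unfolded sets]
      assms(2,3) two_column_dim[of M vs]
    by simp_all
  ultimately show ?thesis
    using assms by (simp add: det_2x2 two_column_index minor_def)
qed

text \<open>There are only two columns to select, so a minor amounts to a choice of two rows in
  increasing order.\<close>

lemma minors_two_column:
  assumes "acts_as M vs f"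
  shows "minors 2 (two_column M vs) = {minor f (vs ! p) (vs ! q) | p q. p < q \<and> q < length vs}"
proof (intro equalityI subsetI)
  fix x assume "x \<in> minors 2 (two_column M vs)"
  then obtain I J where x: "x = det (submatrix (two_column M vs) I J)"
    and I: "I \<subseteq> {..<length vs}" "card I = 2" and J: "J \<subseteq> {..<2}" "card J = 2"
    by (auto simp: minors_def two_column_dim)
  obtain p q where pq: "I = {p, q}" "p < q"
    using I(2) by (metis card_2_iff insert_commute linorder_neqE_nat)
  have "J = {..<2}" using J by (intro card_subset_eq) auto
  then have "J = {0, 1}" by auto
  then show "x \<in> {minor f (vs ! p) (vs ! q) | p q. p < q \<and> q < length vs}"
    using det_submatrix_two_column[OF assms, of p q] pq I by (auto simp: x)
next
  fix x assume "x \<in> {minor f (vs ! p) (vs ! q) | p q. p < q \<and> q < length vs}"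
  then obtain p q where "x = minor f (vs ! p) (vs ! q)" "p < q" "q < length vs" by auto
  then show "x \<in> minors 2 (two_column M vs)"
    using det_submatrix_two_column[OF assms, of p q]
    unfolding minors_def two_column_dim
    by (intro CollectI exI[of _ "{p, q}"] exI[of _ "{0, 1}"]) auto
qed

lemma minors_subset:
  assumes "acts_as M vs f" "\<And>v w. v \<in> set vs \<Longrightarrow> w \<in> set vs \<Longrightarrow> minor f v w \<in> S"
  shows "minors 2 (two_column M vs) \<subseteq> S"
  unfolding minors_two_column[OF assms(1)] using assms(2) by (auto dest: less_trans)

text \<open>Exchanging the rows changes the sign and equal rows give 0, so the order of the rows is
  immaterial.\<close>

lemma minor_in_ideal:
  assumes "acts_as M vs f" "ideal I (poly_ring V)" "minors 2 (two_column M vs) \<subseteq> I"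
    and "v \<in> set vs" "w \<in> set vs"
  shows "minor f v w \<in> I"
proof -
  obtain p q where pq: "v = vs ! p" "p < length vs" "w = vs ! q" "q < length vs"
    using assms(4,5) by (metis in_set_conv_nth)
  have sub: "minor f (vs ! p) (vs ! q) \<in> I" if "p < q" "q < length vs" for p q
    using assms(3) that unfolding minors_two_column[OF assms(1)] by blast
  consider "p < q" | "p = q" | "q < p" by linarith
  then show ?thesis
  proof cases
    case 1
    then show ?thesis using sub pq by simp
  next
    case 2
    then show ?thesis using poly_ideal_0[OF assms(2)] by (simp add: pq minor_def mult.commute)
  next
    case 3
    have "minor f v w = - minor f w v" by (simp add: minor_def mult.commute)
    then show ?thesis using poly_ideal_uminus[OF assms(2) sub[OF 3]] pq by simp
  qed
qed

section \<open>The ideals of the decomposition\<close>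

text \<open>The kernel of the substitution followed by reduction modulo \<epsilon>^e.\<close>

definition eps_ideal :: "idx set \<Rightarrow> idx set \<Rightarrow> nat \<Rightarrow> (idx, 'k::field) mpol set" where
  "eps_ideal V U e = {p \<in> carrier (poly_ring V). monom 1 e dvd eps_map U p}"

lemma eps_ideal_ideal: "ideal (eps_ideal V U e) (poly_ring V)"
  by (rule poly_idealI)
    (auto simp: eps_ideal_def eps_map_add eps_map_mult poly_ring_closed intro: dvd_add dvd_mult)

section \<open>Primality of \<epsilon>, radicals and primary ideals\<close>

lemma eps_map_power: "eps_map U (p ^ m) = eps_map U p ^ m"
  by (induction m) (simp_all add: eps_map_mult)

lemma monom_1_power: "monom (1::'a::comm_semiring_1) 1 ^ m = monom 1 m"
  by (simp add: monom_power)

text \<open>If \<open>p ^ m\<close> divides \<open>a\<close>, cancelling it leaves \<open>p\<close>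
  dividing the cofactor times \<open>b\<close>. For \<open>p\<close> equal to \<epsilon> this is the
  primary condition.\<close>

lemma prime_elem_power_dvd_mult_cases:
  fixes p :: "'a::idom"
  assumes p: "prime_elem p" and "p ^ m dvd a * b"
  shows "p ^ m dvd a \<or> p dvd b"
  using assms(2)
proof (induction m)
  case (Suc m)
  then have "p ^ m dvd a * b" using power_le_dvd le_SucI by blast
  with Suc.IH consider "p dvd b" | c where "a = p ^ m * c" by (auto elim: dvdE)
  then show ?case
  proof cases
    case (2 c)
    with Suc.prems have "p ^ m * p dvd p ^ m * (c * b)" by (simp add: ac_simps)
    then have "p dvd c * b"
      using p by (simp add: prime_elem_def)
    then have "p dvd c \<or> p dvd b" by (rule prime_elem_dvd_multD[OF p])
    with 2 show ?thesis by (auto simp: mult.commute[of p] intro: mult_dvd_mono)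
  qed blast
qed simp

text \<open>Divisibility by \<epsilon> means a vanishing constant coefficient, which is
  multiplicative with values in a domain.\<close>

lemma prime_eps: "prime_elem (monom (1::'a::idom) 1)"
proof -
  have "monom (1::'a) 1 dvd p \<longleftrightarrow> coeff p 0 = 0" for p
    by (simp add: monom_1_dvd_iff')
  then show ?thesis
    unfolding prime_elem_def by (simp add: coeff_mult_0 monom_eq_0_iff)
qed

text \<open>One inclusion is primality of \<epsilon>. For the other, if \<epsilon> divides the image
  of \<open>p\<close>, then \<epsilon>^e divides the image of \<open>p ^ e\<close>.\<close>

lemma radical_eps_ideal:
  assumes "e \<ge> 1"
  shows "radical (poly_ring V) (eps_ideal V U e) = (eps_ideal V U 1 :: (idx, 'k::field) mpol set)"
proof (intro equalityI subsetI)
  fix p :: "(idx, 'k) mpol" assume "p \<in> radical (poly_ring V) (eps_ideal V U e)"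
  then obtain m :: nat where p: "p \<in> carrier (poly_ring V)" and "p ^ m \<in> eps_ideal V U e"
    by (auto simp: radical_def poly_ring_nat_pow)
  then have "monom 1 e dvd eps_map U p ^ m" by (simp add: eps_ideal_def eps_map_power)
  moreover have "monom 1 1 dvd (monom 1 e :: (idx, 'k) mpol poly)"
    using assms by (simp add: monom_1_dvd_iff')
  ultimately have "monom 1 1 dvd eps_map U p ^ m" by (rule dvd_trans[rotated])
  then have "monom 1 1 dvd eps_map U p" by (rule prime_elem_dvd_power[OF prime_eps])
  with p show "p \<in> eps_ideal V U 1" by (simp add: eps_ideal_def)
next
  fix p :: "(idx, 'k) mpol" assume "p \<in> eps_ideal V U 1"
  then have p: "p \<in> carrier (poly_ring V)" and dvd: "monom 1 1 dvd eps_map U p"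
    by (simp_all add: eps_ideal_def)
  from dvd_power_same[OF dvd, of e] have "monom 1 e dvd eps_map U (p ^ e)"
    unfolding eps_map_power monom_1_power .
  moreover have "p ^ e \<in> carrier (poly_ring V)"
    using p by (induction e) (simp_all add: poly_ring_closed)
  ultimately show "p \<in> radical (poly_ring V) (eps_ideal V U e)"
    using p by (auto simp: radical_def eps_ideal_def poly_ring_nat_pow)
qed

lemma primary_eps_ideal:
  assumes "e \<ge> 1"
  shows "primary_ideal (eps_ideal V U e :: (idx, 'k::field) mpol set) (poly_ring V)"
  unfolding primary_ideal_def
proof (intro conjI ballI impI)
  show "ideal (eps_ideal V U e) (poly_ring V)" by (rule eps_ideal_ideal)
  have "\<not> monom 1 e dvd (1 :: (idx, 'k) mpol poly)"
    using assms by (auto simp: monom_1_dvd_iff')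
  then have "1 \<notin> (eps_ideal V U e :: (idx, 'k) mpol set)" by (simp add: eps_ideal_def)
  then show "(eps_ideal V U e :: (idx, 'k) mpol set) \<noteq> carrier (poly_ring V)"
    using poly_ring_closed(2) by blast
next
  fix p q :: "(idx, 'k) mpol"
  assume pq: "p \<in> carrier (poly_ring V)" "q \<in> carrier (poly_ring V)"
    and "p \<otimes>\<^bsub>poly_ring V\<^esub> q \<in> eps_ideal V U e"
  then have "monom 1 1 ^ e dvd eps_map U p * eps_map U q"
    by (simp add: eps_ideal_def eps_map_mult monom_1_power del: One_nat_def)
  then have "monom 1 1 ^ e dvd eps_map U p \<or> monom 1 1 dvd eps_map U q"
    using prime_elem_power_dvd_mult_cases[OF prime_eps] by blast
  then show "p \<in> eps_ideal V U e \<or> q \<in> radical (poly_ring V) (eps_ideal V U e)"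
    using pq unfolding radical_eps_ideal[OF assms] monom_1_power by (auto simp: eps_ideal_def)
qed

section \<open>The substitution that keeps the blocks up to index j\<close>

definition upto_block :: "nat \<Rightarrow> nat \<Rightarrow> idx set" where
  "upto_block i j = {(i', a, b, c). i' = i \<and> a \<le> j}"

lemma in_upto_block: "(i', a, b, c) \<in> upto_block i j \<longleftrightarrow> i' = i \<and> a \<le> j"
  by (simp add: upto_block_def)

lemma base_upto_block [simp]: "base v \<in> upto_block i j \<longleftrightarrow> v \<in> upto_block i j"
  by (cases v) (simp add: base_def upto_block_def)

lemma keys_shape_upto_block:
  "Poly_Mapping.keys (shape m) \<subseteq> upto_block i j \<longleftrightarrow> Poly_Mapping.keys m \<subseteq> upto_block i j"
  unfolding keys_shape image_subset_iff base_upto_block by blast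

lemma fst_upto_block: "Poly_Mapping.keys m \<subseteq> upto_block i j \<Longrightarrow> fst ` Poly_Mapping.keys m \<subseteq> {i}"
  by (auto simp: upto_block_def)

text \<open>A shape supported in \<open>upto_block i j\<close> forces its whole class to survive, so
  the class sum is a coefficient of the image below \<epsilon>^e.\<close>

lemma class_sum_eq_0:
  assumes "p \<in> eps_ideal V (upto_block i j) e" "Poly_Mapping.keys s \<subseteq> upto_block i j" "e' < e"
  shows "(\<Sum>m | m \<in> Poly_Mapping.keys p \<and> (shape m, excess m) = (s, e'). Poly_Mapping.lookup p m) = 0"
proof -
  have "coeff (eps_map (upto_block i j) p) e' = 0"
    using assms(1,3) by (simp add: eps_ideal_def monom_1_dvd_iff')
  moreover have "{m \<in> Poly_Mapping.keys p. Poly_Mapping.keys m \<subseteq> upto_block i j \<and> shape m = s \<and> excess m = e'} =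
      {m \<in> Poly_Mapping.keys p. (shape m, excess m) = (s, e')}"
    using assms(2) keys_shape_upto_block[of _ i j] by auto
  ultimately show ?thesis
    using lookup_coeff_eps_map[of "upto_block i j" p e' s] by simp
qed

text \<open>Multiplying u \<epsilon>^(c-1) by \<epsilon> gives the image of the next variable in the
  block. Only at the block end is there an error, u \<epsilon>^c with \<open>c \<ge> r i a\<close>,
  and surviving blocks have size at least \<open>r i j\<close>.\<close>

lemma dvd_eps_map_jordan_row:
  fixes lam :: "nat \<Rightarrow> 'k::field"
  assumes "v = (i', a, b, c)" "1 \<le> c" "i' = i \<Longrightarrow> a \<le> j \<Longrightarrow> r i j \<le> r i a"
  shows "monom 1 (r i j) dvd eps_map (upto_block i j) (jordan_row lam r v) -
    (monom (const (lam i)) 0 + monom 1 1) * eps_map (upto_block i j) (var v)"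
proof (cases "v \<in> upto_block i j")
  case False
  then show ?thesis
    using assms by (auto simp: jordan_row_def tvar_def eps_map_add eps_map_mult eps_map_var upto_block_def)
next
  case True
  then have v: "i' = i" "a \<le> j" using assms(1) by (auto simp: upto_block_def)
  have U: "(i, a, b, c') \<in> upto_block i j" for c' using v by (simp add: upto_block_def)
  have c: "off (i, a, b, c) = c - 1" "off (i, a, b, Suc c) = Suc (c - 1)"
    using assms(2) by (simp_all add: off_def)
  have const: "eps_map (upto_block i j) (const (lam i)) = monom (const (lam i)) 0"
    by (simp add: const_def eps_map_single)
  have "eps_map (upto_block i j) (jordan_row lam r v) =
      (monom (const (lam i)) 0 + monom 1 1) * eps_map (upto_block i j) (var v) -
      (if Suc c \<le> r i a then 0 else monom (var (base v)) c)"
    using assms(1,2) v U c const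
    by (simp add: jordan_row_def tvar_def eps_map_add eps_map_mult eps_map_var distrib_right mult_monom base_def)
  moreover have "monom 1 (r i j) dvd (if Suc c \<le> r i a then 0 else monom (var (base v) :: (idx, 'k) mpol) c)"
    using assms(3)[OF v] by (auto simp: monom_1_dvd_iff')
  ultimately show ?thesis by simp
qed

lemma minor_in_eps_ideal:
  fixes lam :: "nat \<Rightarrow> 'k::field"
  assumes V: "v \<in> V" "w \<in> V"
    and row: "\<And>u. u \<in> V \<Longrightarrow> jordan_row lam r u \<in> carrier (poly_ring V)"
    and dvd: "\<And>u. u \<in> V \<Longrightarrow> monom 1 (r i j) dvd eps_map (upto_block i j) (jordan_row lam r u) -
      (monom (const (lam i)) 0 + monom 1 1) * eps_map (upto_block i j) (var u)"
  shows "minor (jordan_row lam r) v w \<in> eps_ideal V (upto_block i j) (r i j)"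
proof -
  let ?\<phi> = "eps_map (upto_block i j) :: (idx, 'k) mpol \<Rightarrow> _" and ?L = "monom (const (lam i)) 0 + monom 1 1 :: (idx, 'k) mpol poly"
  \<comment> \<open>The products \<open>?L * ?\<phi> (var v) * ?\<phi> (var w)\<close> cancel, which
    leaves one multiple of each row error.\<close>
  have "?\<phi> (minor (jordan_row lam r) v w) =
      (?\<phi> (jordan_row lam r v) - ?L * ?\<phi> (var v)) * ?\<phi> (var w) - ?\<phi> (var v) * (?\<phi> (jordan_row lam r w) - ?L * ?\<phi> (var w))"
    by (simp add: minor_def eps_map_diff eps_map_mult algebra_simps)
  then have "monom 1 (r i j) dvd ?\<phi> (minor (jordan_row lam r) v w)"
    using dvd_diff[OF dvd_mult2[OF dvd[OF V(1)]] dvd_mult[OF dvd[OF V(2)]]] by (rule ssubst)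
  then show ?thesis
    using V row by (simp add: eps_ideal_def minor_def poly_ring_closed var_in_poly_ring)
qed

lemma var_in_eps_ideal_iff:
  assumes "v \<in> V"
  shows "(var v :: (idx, 'k::field) mpol) \<in> eps_ideal V U e \<longleftrightarrow> v \<notin> U \<or> e \<le> off v"
  using assms
proof -
  have "monom 1 e dvd (monom (var (base v)) (off v) :: (idx, 'k) mpol poly) \<longleftrightarrow> e \<le> off v"
    unfolding monom_1_dvd_iff' by (auto simp: not_less)
  moreover have "(var v :: (idx, 'k) mpol) \<in> carrier (poly_ring V)"
    using assms by (rule var_in_poly_ring)
  ultimately show ?thesis by (simp add: eps_ideal_def eps_map_var)
qed

text \<open>The normal form of \<open>m\<close> at the block \<open>(a, b)\<close> is a multiple of
  the assumed element of \<open>I\<close>.\<close>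

lemma (in shift_ideal) mon_zero:
  assumes "Poly_Mapping.keys m \<subseteq> V" "fst ` Poly_Mapping.keys m \<subseteq> {i}" "(i, a, b, c) \<in> Poly_Mapping.keys m"
    and "tvar r (i, a, b, Suc (excess m)) \<in> I"
  shows "mon m \<in> I"
proof -
  have "mon (shape m - vmon (i, a, b, 1)) \<in> carrier (poly_ring V)"
    by (rule mon_in_poly_ring[OF order_trans[OF keys_diff_nat shape_in[OF assms(1)]]])
  from poly_ideal_add[OF I mon_normal_form[OF assms(1-3)] poly_ideal_mult_right[OF I assms(4) this]]
  show ?thesis by (simp only: diff_add_cancel)
qed

lemma mon_in_ideal_of_var:
  assumes "ideal I (poly_ring V)" "Poly_Mapping.keys m \<subseteq> V" "v \<in> Poly_Mapping.keys m" "var v \<in> I"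
  shows "mon m \<in> I"
proof -
  from assms(3) obtain m' where m: "m = vmon v + m'" by (rule remove_vmon)
  have "mon m' \<in> carrier (poly_ring V)"
    using assms(2) by (intro mon_in_poly_ring) (simp add: m keys_add_nat)
  from poly_ideal_mult_right[OF assms(1,4) this] show ?thesis by (simp only: m mon_vmon_add)
qed

text \<open>Class sums vanish on the surviving classes, where monomials are congruent modulo
  \<open>I\<close>; monomials of all other classes lie in \<open>I\<close> by \<open>outside\<close>
  and \<open>long\<close>.\<close>

lemma (in shift_ideal) eps_ideal_subset:
  assumes outside: "\<And>v. v \<in> V \<Longrightarrow> v \<notin> upto_block i j \<Longrightarrow> var v \<in> I"
    and long: "\<And>a b c. (i, a, b, c) \<in> V \<Longrightarrow> c > r i j \<Longrightarrow> var (i, a, b, c) \<in> I"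
    and rpos: "r i j \<ge> 1"
  shows "eps_ideal V (upto_block i j) (r i j) \<subseteq> I"
proof
  fix p :: "(idx, 'k) mpol" assume p: "p \<in> eps_ideal V (upto_block i j) (r i j)"
  \<comment> \<open>\<open>?Z\<close> marks the classes whose image vanishes modulo the power of
    \<epsilon> with exponent \<open>r i j\<close>.\<close>
  let ?Z = "\<lambda>(s, e). \<not> (Poly_Mapping.keys s \<subseteq> upto_block i j \<and> e < r i j)"
  show "p \<in> I"
  proof (rule mem_ideal_by_classes[where g = "\<lambda>m. (shape m, excess m)" and Z = ?Z, OF I])
    show "p \<in> carrier (poly_ring V)" using p by (simp add: eps_ideal_def)
  next
    fix m assume m: "Poly_Mapping.keys m \<subseteq> V" and Z: "?Z (shape m, excess m)"
    show "mon m \<in> I"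
    proof (cases "Poly_Mapping.keys m \<subseteq> upto_block i j")
      case False
      then obtain v where "v \<in> Poly_Mapping.keys m" "v \<notin> upto_block i j" by blast
      with subsetD[OF m] outside[of v] show ?thesis by (intro mon_in_ideal_of_var[OF I m]) simp_all
    next
      case True
      with Z have e: "r i j \<le> excess m" by (simp add: keys_shape_upto_block)
      with rpos have "m \<noteq> 0" by auto
      then obtain v where v: "v \<in> Poly_Mapping.keys m" by (rule nonzero_obtain_key)
      with True have "v \<in> upto_block i j" by blast
      then obtain a b c where v_eq: "v = (i, a, b, c)" by (cases v) (simp add: upto_block_def)
      have V: "(i, a, b, c) \<in> V" using subsetD[OF m v] unfolding v_eq .
      \<comment> \<open>This position exceeds \<open>r i j\<close>: the variable there is past its
        block end, hence 0, or covered by \<open>long\<close>.\<close>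
      have "tvar r (i, a, b, Suc (excess m)) \<in> I"
        using long[of a b "Suc (excess m)"] closed[OF V, of "Suc (excess m)"] e poly_ideal_0[OF I]
        by (simp add: tvar_def)
      then show ?thesis
        by (rule mon_zero[OF m fst_upto_block[OF True] v[unfolded v_eq]])
    qed
  next
    fix m m' assume V: "Poly_Mapping.keys m \<subseteq> V" "Poly_Mapping.keys m' \<subseteq> V"
      and Z: "\<not> ?Z (shape m, excess m)" and eq: "(shape m, excess m) = (shape m', excess m')"
    from Z have "Poly_Mapping.keys m \<subseteq> upto_block i j" by (simp add: keys_shape_upto_block)
    then show "mon m - mon m' \<in> I"
      using V eq by (intro mon_cong[of m i] fst_upto_block) simp_all
  next
    fix \<gamma> :: "(idx \<Rightarrow>\<^sub>0 nat) \<times> nat" assume Z: "\<not> ?Z \<gamma>"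
    obtain s e where \<gamma>: "\<gamma> = (s, e)" by (cases \<gamma>)
    show "(\<Sum>m | m \<in> Poly_Mapping.keys p \<and> (shape m, excess m) = \<gamma>. Poly_Mapping.lookup p m) = 0"
      unfolding \<gamma> by (rule class_sum_eq_0[OF p]) (use Z in \<open>simp_all add: \<gamma>\<close>)
  qed
qed

section \<open>Identification of the components\<close>

lemma genideal_poly_ring_minimal:
  assumes "ideal I (poly_ring V)" "S \<subseteq> I"
  shows "Idl\<^bsub>poly_ring V\<^esub> S \<subseteq> I"
  using assms by (auto simp: genideal_def)

lemma genideal_poly_ring:
  assumes "S \<subseteq> carrier (poly_ring V)"
  shows "ideal (Idl\<^bsub>poly_ring V\<^esub> S) (poly_ring V)" "S \<subseteq> Idl\<^bsub>poly_ring V\<^esub> S"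
proof -
  interpret cring "poly_ring V" by (rule poly_ring_cring)
  show "ideal (Idl\<^bsub>poly_ring V\<^esub> S) (poly_ring V)" using assms by (rule genideal_ideal)
  show "S \<subseteq> Idl\<^bsub>poly_ring V\<^esub> S" using assms by (rule genideal_self)
qed

lemma set_add_poly_ring: "A <+>\<^bsub>poly_ring V\<^esub> B = {a + b | a b. a \<in> A \<and> b \<in> B}"
  by (auto simp: set_add_def' poly_ring_def)

lemma in_all_vars: "(i, a, b, c) \<in> all_vars n l k r \<longleftrightarrow> i \<in> {1..n} \<and> (i, a, b, c) \<in> Lam l k r i"
  by (auto simp: all_vars_eq Lam_iff)

locale jordan_data =
  fixes n :: nat and lam :: "nat \<Rightarrow> 'k::field" and l :: "nat \<Rightarrow> nat" and k r :: "nat \<Rightarrow> nat \<Rightarrow> nat"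
  assumes n: "n \<ge> 1"
    and lam_inj: "inj_on lam {1..n}"
    and l_pos: "i \<in> {1..n} \<Longrightarrow> l i \<ge> 1"
    and k_pos: "i \<in> {1..n} \<Longrightarrow> j \<in> {1..l i} \<Longrightarrow> k i j \<ge> 1"
    and r_pos: "i \<in> {1..n} \<Longrightarrow> j \<in> {1..l i} \<Longrightarrow> r i j \<ge> 1"
    and r_dec: "i \<in> {1..n} \<Longrightarrow> j \<in> {1..l i} \<Longrightarrow> j' \<in> {1..l i} \<Longrightarrow> j < j' \<Longrightarrow> r i j > r i j'"
begin

abbreviation vars where "vars \<equiv> all_vars n l k r"
abbreviation block_vars where "block_vars \<equiv> Lam l k r"
abbreviation Q :: "idx set \<Rightarrow> nat \<Rightarrow> nat \<Rightarrow> (idx, 'k) mpol set" where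
  "Q V i j \<equiv> eps_ideal V (upto_block i j) (r i j)"

lemma r_antimono: "i \<in> {1..n} \<Longrightarrow> 1 \<le> a \<Longrightarrow> a \<le> j \<Longrightarrow> j \<le> l i \<Longrightarrow> r i j \<le> r i a"
  using r_dec[of i a j] by (cases "a = j") auto

lemma block_vars_subset: "i \<in> {1..n} \<Longrightarrow> block_vars i \<subseteq> vars"
  by (auto simp: all_vars_eq)

lemma tvar_in_poly_ring:
  assumes "(i, a, b, c) \<in> block_vars i" "block_vars i \<subseteq> V" "1 \<le> c'"
  shows "tvar r (i, a, b, c') \<in> carrier (poly_ring V)"
proof (cases "c' \<le> r i a")
  case True
  with assms have "(i, a, b, c') \<in> V" by (auto simp: Lam_iff)
  then show ?thesis by (simp add: tvar_def var_in_poly_ring poly_ring_closed)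
qed (simp add: tvar_def poly_ring_closed)

lemma jordan_row_in_poly_ring:
  assumes "v \<in> block_vars i" "block_vars i \<subseteq> V"
  shows "jordan_row lam r v \<in> carrier (poly_ring V)"
proof -
  obtain i' a b c where v: "v = (i', a, b, c)" by (cases v)
  with assms(1) have i: "i' = i" by (simp add: Lam_iff)
  have "var v \<in> carrier (poly_ring V)" using assms by (intro var_in_poly_ring) blast
  moreover have "tvar r (i, a, b, Suc c) \<in> carrier (poly_ring V)"
    using assms unfolding v i by (intro tvar_in_poly_ring) simp_all
  ultimately show ?thesis
    unfolding v i jordan_row_def prod.case by (intro poly_ring_closed const_in_poly_ring)
qed

text \<open>Block sizes decrease with the index, so all surviving blocks have size at least
  \<open>r i j\<close>, as the row estimate requires. The two choices of \<open>V\<close> serve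
  \<open>q_ideal\<close> and \<open>component\<close>.\<close>

lemma minor_in_Q:
  assumes i: "i \<in> {1..n}" "j \<in> {1..l i}" and V: "V = block_vars i \<or> V = vars"
    and vw: "v \<in> V" "w \<in> V"
  shows "minor (jordan_row lam r) v w \<in> Q V i j"
proof (rule minor_in_eps_ideal[OF vw])
  fix u assume u: "u \<in> V"
  obtain i' a b c where u_eq: "u = (i', a, b, c)" by (cases u)
  have sub: "V \<subseteq> vars" using V block_vars_subset[OF i(1)] by auto
  then have i': "i' \<in> {1..n}" "(i', a, b, c) \<in> block_vars i'"
    using u unfolding u_eq by (auto simp: in_all_vars)
  have "block_vars i' \<subseteq> V"
    using V u block_vars_subset[OF i'(1)] unfolding u_eq by (auto simp: Lam_iff)
  then show "jordan_row lam r u \<in> carrier (poly_ring V)"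
    using jordan_row_in_poly_ring[of u i' V] i'(2) by (simp add: u_eq)
  show "monom 1 (r i j) dvd eps_map (upto_block i j) (jordan_row lam r u) -
      (monom (const (lam i)) 0 + monom 1 1) * eps_map (upto_block i j) (var u)"
  proof (rule dvd_eps_map_jordan_row[OF u_eq])
    show "1 \<le> c" using i'(2) by (simp add: Lam_iff)
    show "r i j \<le> r i a" if "i' = i" "a \<le> j"
      using i'(2) that i by (intro r_antimono) (simp_all add: Lam_iff)
  qed
qed

text \<open>For rows of equal eigenvalue the terms with \<open>lam i\<close> cancel in the minor,
  which leaves the polynomial of \<open>shift\<close>.\<close>

lemma shift_idealI:
  assumes I: "ideal I (poly_ring V)" and V: "V = block_vars i \<or> V = vars"
    and minors: "\<And>i v w. v \<in> V \<inter> block_vars i \<Longrightarrow> w \<in> V \<inter> block_vars i \<Longrightarrow> minor (jordan_row lam r) v w \<in> I"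
  shows "shift_ideal r V I"
proof (rule shift_ideal.intro)
  show "ideal I (poly_ring V)" by fact
  show "1 \<le> c \<and> c \<le> r i a" if "(i, a, b, c) \<in> V" for i a b c
    using V that by (auto simp: Lam_iff in_all_vars)
  show "(i, a, b, c') \<in> V" if "(i, a, b, c) \<in> V" "1 \<le> c'" "c' \<le> r i a" for i a b c c'
    using V that by (auto simp: Lam_iff in_all_vars)
  show "tvar r (i, a, b, Suc c) * var (i, a', b', c') - var (i, a, b, c) * tvar r (i, a', b', Suc c') \<in> I"
    if "(i, a, b, c) \<in> V" "(i, a', b', c') \<in> V" for i a b c a' b' c'
  proof -
    have "(i, a, b, c) \<in> V \<inter> block_vars i" "(i, a', b', c') \<in> V \<inter> block_vars i"
      using V that by (auto simp: Lam_iff in_all_vars)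
    from minors[OF this] show ?thesis
      by (simp add: minor_def jordan_row_def algebra_simps)
  qed
qed

text \<open>The minors supply the shift relations, and the adjoined variables are exactly those
  whose image is divisible by the required power of \<epsilon>.\<close>

lemma q_ideal_eq:
  assumes i: "i \<in> {1..n}" "j \<in> {1..l i}"
  shows "q_ideal lam l k r i j = Q (block_vars i) i j"
proof (rule equalityI)
  let ?X = "{var (i, a, b, c) | a b c. (i, a, b, c) \<in> Lam l k r i \<and> (a \<le> j \<and> c \<ge> r i j + 1 \<or> a > j)} :: (idx, 'k) mpol set"
  let ?M = "minors 2 (two_column (J_eig lam l k r i) (Lam_list l k r i))"
  have M: "?M \<subseteq> Q (block_vars i) i j"
    using i by (intro minors_subset[OF acts_as_J_eig] minor_in_Q) simp_all
  have "?X \<subseteq> Q (block_vars i) i j"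
    by (auto simp: var_in_eps_ideal_iff upto_block_def off_def)
  with M have gen: "?M \<union> ?X \<subseteq> Q (block_vars i) i j" by (rule Un_least)
  show "q_ideal lam l k r i j \<subseteq> Q (block_vars i) i j"
    unfolding q_ideal_def by (rule genideal_poly_ring_minimal[OF eps_ideal_ideal gen])
  have "?M \<union> ?X \<subseteq> carrier (poly_ring (block_vars i))"
    using gen by (rule order_trans) (auto simp: eps_ideal_def)
  note gI = genideal_poly_ring[OF this, folded q_ideal_def]
  have minor: "minor (jordan_row lam r) v w \<in> q_ideal lam l k r i j" if "v \<in> block_vars i" "w \<in> block_vars i" for v w
    using gI that by (intro minor_in_ideal[OF acts_as_J_eig gI(1)]) simp_all
  interpret shift_ideal r "block_vars i" "q_ideal lam l k r i j"
    using gI(1) minor by (intro shift_idealI[of _ _ i]) simp_all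
  have var: "var (i, a, b, c) \<in> q_ideal lam l k r i j"
    if "(i, a, b, c) \<in> block_vars i" "a \<le> j \<and> c \<ge> r i j + 1 \<or> a > j" for a b c
    using gI(2) that by blast
  show "Q (block_vars i) i j \<subseteq> q_ideal lam l k r i j"
  proof (rule eps_ideal_subset)
    show "var v \<in> q_ideal lam l k r i j" if "v \<in> block_vars i" "v \<notin> upto_block i j" for v
    proof -
      obtain i' a b c where v: "v = (i', a, b, c)" by (cases v)
      then show ?thesis using that var[of a b c] by (simp add: Lam_iff upto_block_def)
    qed
    show "var (i, a, b, c) \<in> q_ideal lam l k r i j" if "(i, a, b, c) \<in> block_vars i" "c > r i j" for a b c
      using that var[of a b c] by (cases "a \<le> j") simp_all
    show "r i j \<ge> 1" using i by (rule r_pos)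
  qed
qed

text \<open>The argument for \<open>q_ideal\<close> is repeated in the full ring, where
  \<open>p_ideal\<close> supplies the variables of the other eigenvalues.\<close>

lemma component_eq:
  assumes i: "i \<in> {1..n}" "j \<in> {1..l i}"
  shows "component n lam l k r i j = Q vars i j"
proof (rule equalityI)
  interpret cring "poly_ring vars :: (idx, 'k) mpol ring" by (rule poly_ring_cring)
  let ?P = "{var (i', a, b, c) | i' a b c. (i', a, b, c) \<in> all_vars n l k r \<and> i' \<noteq> i} :: (idx, 'k) mpol set"
  let ?q = "Idl\<^bsub>poly_ring vars\<^esub> q_ideal lam l k r i j"
  have sub: "block_vars i \<subseteq> vars" using i(1) by (rule block_vars_subset)
  have q: "q_ideal lam l k r i j \<subseteq> Q vars i j"
    unfolding q_ideal_eq[OF i] eps_ideal_def using poly_ring_mono[OF sub] by blast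
  have P: "?P \<subseteq> Q vars i j"
    by (auto simp: var_in_eps_ideal_iff upto_block_def)
  have carrier: "Q vars i j \<subseteq> carrier (poly_ring vars)" by (auto simp: eps_ideal_def)
  note I1 = genideal_poly_ring[OF order_trans[OF q carrier]]
  note I2 = genideal_poly_ring[OF order_trans[OF P carrier], folded p_ideal_def]
  have I: "ideal (component n lam l k r i j) (poly_ring vars)"
    unfolding component_def by (rule add_ideals[OF I1(1) I2(1)])
  have "?q \<subseteq> Q vars i j"
    by (rule genideal_poly_ring_minimal[OF eps_ideal_ideal q])
  moreover have "p_ideal n l k r i \<subseteq> Q vars i j"
    unfolding p_ideal_def by (rule genideal_poly_ring_minimal[OF eps_ideal_ideal P])
  ultimately show "component n lam l k r i j \<subseteq> Q vars i j"
    unfolding component_def set_add_poly_ring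
    using poly_ideal_add[OF eps_ideal_ideal[of vars "upto_block i j" "r i j"]] by blast
  have incl: "q_ideal lam l k r i j \<subseteq> component n lam l k r i j" "p_ideal n l k r i \<subseteq> component n lam l k r i j"
  proof -
    show "q_ideal lam l k r i j \<subseteq> component n lam l k r i j"
    proof
      fix x assume "x \<in> q_ideal lam l k r i j"
      with I1(2) have "x \<in> ?q" by blast
      moreover have "x = x + 0" by simp
      ultimately show "x \<in> component n lam l k r i j"
        unfolding component_def set_add_poly_ring using poly_ideal_0[OF I2(1)] by blast
    qed
    show "p_ideal n l k r i \<subseteq> component n lam l k r i j"
    proof
      fix x :: "(idx, 'k) mpol" assume "x \<in> p_ideal n l k r i"
      moreover have "x = 0 + x" by simp
      ultimately show "x \<in> component n lam l k r i j"
        unfolding component_def set_add_poly_ring using poly_ideal_0[OF I1(1)] by blast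
    qed
  qed
  have out: "var v \<in> component n lam l k r i j" if "v \<in> vars" "v \<notin> block_vars i" for v
  proof -
    obtain i' a b c where v: "v = (i', a, b, c)" by (cases v)
    have "i' \<noteq> i" using that by (auto simp: v in_all_vars)
    then have "var v \<in> ?P" using that(1) by (auto simp: v)
    then have "(var v :: (idx, 'k) mpol) \<in> p_ideal n l k r i" by (rule subsetD[OF I2(2)])
    then show ?thesis using incl(2) by blast
  qed
  \<comment> \<open>Shift relations are required for every eigenvalue: for \<open>i\<close> the
    minors lie in \<open>q_ideal\<close>, for the others each term has a factor in
    \<open>p_ideal\<close>.\<close>
  have minor: "minor (jordan_row lam r) v w \<in> component n lam l k r i j"
    if vw: "v \<in> vars \<inter> block_vars i'" "w \<in> vars \<inter> block_vars i'" for i' v w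
  proof (cases "i' = i")
    case True
    have "minor (jordan_row lam r) v w \<in> q_ideal lam l k r i j"
      unfolding q_ideal_eq[OF i] using True vw i by (intro minor_in_Q) simp_all
    then show ?thesis using incl(1) by blast
  next
    case False
    have "block_vars i' \<inter> block_vars i = {}" using False by (auto simp: Lam_iff)
    then have "var v \<in> component n lam l k r i j" "var w \<in> component n lam l k r i j"
      using vw out by blast+
    moreover have "block_vars i' \<subseteq> vars"
      using vw(1) by (cases v) (auto simp: Lam_iff in_all_vars)
    then have "jordan_row lam r v \<in> carrier (poly_ring vars)" "jordan_row lam r w \<in> carrier (poly_ring vars)"
      using vw by (auto intro: jordan_row_in_poly_ring)
    ultimately show ?thesis
      unfolding minor_def
      by (intro poly_ideal_diff[OF I] poly_ideal_mult[OF I] poly_ideal_mult_right[OF I])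
  qed
  interpret S: shift_ideal r vars "component n lam l k r i j"
    using I minor by (intro shift_idealI[of _ _ i]) simp_all
  have q_var: "var (i, a, b, c) \<in> component n lam l k r i j"
    if "(i, a, b, c) \<in> block_vars i" "c > r i j \<or> a > j" for a b c
  proof -
    have "var (i, a, b, c) \<in> q_ideal lam l k r i j"
      unfolding q_ideal_eq[OF i] using that by (auto simp: var_in_eps_ideal_iff upto_block_def off_def)
    then show ?thesis using incl(1) by blast
  qed
  show "Q vars i j \<subseteq> component n lam l k r i j"
  proof (rule S.eps_ideal_subset)
    show "var v \<in> component n lam l k r i j" if "v \<in> vars" "v \<notin> upto_block i j" for v
    proof -
      obtain i' a b c where v: "v = (i', a, b, c)" by (cases v)
      show ?thesis
        using that q_var[of a b c] out[OF that(1)] by (cases "i' = i") (auto simp: v upto_block_def Lam_iff)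
    qed
    show "var (i, a, b, c) \<in> component n lam l k r i j" if "(i, a, b, c) \<in> vars" "c > r i j" for a b c
      using that q_var[of a b c] by (simp add: in_all_vars)
    show "r i j \<ge> 1" using i by (rule r_pos)
  qed
qed

end

section \<open>The primary decomposition\<close>

context jordan_data
begin

lemma mixed_product:
  assumes I: "ideal I (poly_ring vars)"
    and minors: "\<And>v w. v \<in> vars \<Longrightarrow> w \<in> vars \<Longrightarrow> minor (jordan_row lam r) v w \<in> I"
    and "(i, a, b, c) \<in> vars" "(i', a', b', c') \<in> vars" "i \<noteq> i'"
  shows "var (i, a, b, c) * var (i', a', b', c') \<in> I"
  using assms(3-)
  \<comment> \<open>The minor is \<open>lam i - lam i'\<close> times the product, up to products closer to the block ends.\<close>
proof (induction "(r i a - c) + (r i' a' - c')" arbitrary: c c' rule: less_induct)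
  case less
  let ?v = "(i, a, b, c)" and ?w = "(i', a', b', c')"
  have V: "c \<le> r i a" "c' \<le> r i' a'" "i \<in> {1..n}" "i' \<in> {1..n}"
    using less.prems by (auto simp: in_all_vars Lam_iff)
  \<comment> \<open>At the block end this product is 0, so the induction has no separate base
    case.\<close>
  have "tvar r (i, a, b, Suc c) * var ?w \<in> I"
  proof (cases "Suc c \<le> r i a")
    case True
    then have "(i, a, b, Suc c) \<in> vars" using less.prems(1) by (simp add: in_all_vars Lam_iff)
    with less.hyps[of "Suc c" c'] less.prems True show ?thesis by (simp add: tvar_def)
  qed (simp add: tvar_def poly_ideal_0[OF I])
  moreover have "var ?v * tvar r (i', a', b', Suc c') \<in> I"
  proof (cases "Suc c' \<le> r i' a'")
    case True
    then have "(i', a', b', Suc c') \<in> vars" using less.prems(2) by (simp add: in_all_vars Lam_iff)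
    with less.hyps[of c "Suc c'"] less.prems True show ?thesis by (simp add: tvar_def)
  qed (simp add: tvar_def poly_ideal_0[OF I])
  ultimately have *: "minor (jordan_row lam r) ?v ?w - (tvar r (i, a, b, Suc c) * var ?w - var ?v * tvar r (i', a', b', Suc c')) \<in> I"
    using minors[OF less.prems(1,2)] by (intro poly_ideal_diff[OF I])
  have "lam i - lam i' \<noteq> 0"
    using lam_inj less.prems(3) V(3,4) by (auto dest: inj_onD)
  then have inv: "const (inverse (lam i - lam i')) * (const (lam i) - const (lam i')) = (1 :: (idx, 'k) mpol)"
    by (simp add: const_def mult_single flip: single_diff)
  have "minor (jordan_row lam r) ?v ?w - (tvar r (i, a, b, Suc c) * var ?w - var ?v * tvar r (i', a', b', Suc c')) =
      (const (lam i) - const (lam i')) * (var ?v * var ?w)"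
    by (simp add: minor_def jordan_row_def algebra_simps)
  with * have "(const (lam i) - const (lam i')) * (var ?v * var ?w) \<in> I" by (simp only:)
  from poly_ideal_mult[OF I this const_in_poly_ring[of "inverse (lam i - lam i')"]]
  show ?case unfolding mult.assoc[symmetric] inv by simp
qed

text \<open>A class that survives in some component has coefficient sum 0, and a monomial killed in
  every component already lies in \<open>I_J\<close>.\<close>

lemma I_J_eq: "I_J n lam l k r = carrier (poly_ring vars) \<inter> (\<Inter>(i, j)\<in>(SIGMA i:{1..n}. {1..l i}). Q vars i j)"
proof (rule equalityI)
  let ?M = "minors 2 (two_column (J_mat n lam l k r) (all_list n l k r))"
  let ?D = "carrier (poly_ring vars) \<inter> (\<Inter>(i, j)\<in>(SIGMA i:{1..n}. {1..l i}). Q vars i j)"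
  have M: "?M \<subseteq> Q vars i j" if "i \<in> {1..n}" "j \<in> {1..l i}" for i j
    using that by (intro minors_subset[OF acts_as_J_mat] minor_in_Q) simp_all
  \<comment> \<open>The component \<open>(1, 1)\<close> exists; it shows that the minors lie in the
    ring, and later that \<open>m\<close> is not 0.\<close>
  have one: "1 \<in> {1..n}" "1 \<in> {1..l 1}" using n l_pos by auto
  have carrier: "?M \<subseteq> carrier (poly_ring vars)"
    using M[OF one] by (rule order_trans) (auto simp: eps_ideal_def)
  note gI = genideal_poly_ring[OF carrier, folded I_J_def]
  have "I_J n lam l k r \<subseteq> Q vars i j" if "i \<in> {1..n}" "j \<in> {1..l i}" for i j
    unfolding I_J_def by (rule genideal_poly_ring_minimal[OF eps_ideal_ideal M[OF that]])
  then show "I_J n lam l k r \<subseteq> ?D" using poly_ideal_subset[OF gI(1)] by blast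
  have minors: "minor (jordan_row lam r) v w \<in> I_J n lam l k r" if "v \<in> vars" "w \<in> vars" for v w
    using gI that by (intro minor_in_ideal[OF acts_as_J_mat gI(1)]) simp_all
  interpret shift_ideal r vars "I_J n lam l k r"
    using gI(1) minors by (intro shift_idealI[of _ _ 1]) simp_all
  show "?D \<subseteq> I_J n lam l k r"
  proof
    fix p assume p: "p \<in> ?D"
    let ?Z = "\<lambda>(s, e). \<forall>i\<in>{1..n}. \<forall>j\<in>{1..l i}. \<not> (Poly_Mapping.keys s \<subseteq> upto_block i j \<and> e < r i j)"
    have NZ: thesis
      if "\<not> ?Z (s, e)" "\<And>i j. i \<in> {1..n} \<Longrightarrow> j \<in> {1..l i} \<Longrightarrow> Poly_Mapping.keys s \<subseteq> upto_block i j \<Longrightarrow> e < r i j \<Longrightarrow> thesis"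
      for s :: "idx \<Rightarrow>\<^sub>0 nat" and e thesis
      using that by auto
    show "p \<in> I_J n lam l k r"
    proof (rule mem_ideal_by_classes[where g = "\<lambda>m. (shape m, excess m)" and Z = ?Z, OF gI(1)])
      show "p \<in> carrier (poly_ring vars)" using p by blast
    next
      fix m m' assume m: "Poly_Mapping.keys m \<subseteq> vars" "Poly_Mapping.keys m' \<subseteq> vars"
        and Z: "\<not> ?Z (shape m, excess m)" and eq: "(shape m, excess m) = (shape m', excess m')"
      from Z obtain i j where "Poly_Mapping.keys m \<subseteq> upto_block i j"
        by (rule NZ) (simp add: keys_shape_upto_block)
      then show "mon m - mon m' \<in> I_J n lam l k r"
        using m eq by (intro mon_cong[of m i] fst_upto_block) simp_all
    next
      fix \<gamma> :: "(idx \<Rightarrow>\<^sub>0 nat) \<times> nat" assume Z: "\<not> ?Z \<gamma>"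
      obtain s e where \<gamma>: "\<gamma> = (s, e)" by (cases \<gamma>)
      from Z[unfolded \<gamma>] obtain i j where ij: "i \<in> {1..n}" "j \<in> {1..l i}"
        "Poly_Mapping.keys s \<subseteq> upto_block i j" "e < r i j" by (rule NZ)
      with p have "p \<in> Q vars i j" by blast
      from class_sum_eq_0[OF this ij(3,4)]
      show "(\<Sum>m | m \<in> Poly_Mapping.keys p \<and> (shape m, excess m) = \<gamma>. Poly_Mapping.lookup p m) = 0"
        unfolding \<gamma> .
    next
      fix m assume m: "Poly_Mapping.keys m \<subseteq> vars" and "?Z (shape m, excess m)"
      then have Z: "r i j \<le> excess m" if "i \<in> {1..n}" "j \<in> {1..l i}" "Poly_Mapping.keys m \<subseteq> upto_block i j" for i j
        using that by (auto simp: keys_shape_upto_block not_less)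
      \<comment> \<open>The empty support lies in every \<open>upto_block\<close>, so
        \<open>m = 0\<close> would need excess at least \<open>r 1 1\<close>.\<close>
      have "m \<noteq> 0" using Z[OF one] r_pos[OF one] by auto
      then obtain v where "v \<in> Poly_Mapping.keys m" by (rule nonzero_obtain_key)
      moreover obtain i a0 b0 c0 where "v = (i, a0, b0, c0)" by (cases v)
      ultimately have v: "(i, a0, b0, c0) \<in> Poly_Mapping.keys m" by simp
      show "mon m \<in> I_J n lam l k r"
      proof (cases "fst ` Poly_Mapping.keys m \<subseteq> {i}")
        \<comment> \<open>Two eigenvalues occur, so the monomial is a multiple of a mixed
          product.\<close>
        case False
        then obtain w where w: "w \<in> Poly_Mapping.keys m" "fst w \<noteq> i" by blast
        obtain i' a' b' c' where w_eq: "w = (i', a', b', c')" by (cases w)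
        from v obtain m1 where m1: "m = vmon (i, a0, b0, c0) + m1" by (rule remove_vmon)
        with w have "w \<in> Poly_Mapping.keys m1" by (auto simp: keys_add_nat)
        then obtain m2 where m2: "m1 = vmon w + m2" by (rule remove_vmon)
        have "var (i, a0, b0, c0) * var w \<in> I_J n lam l k r"
          unfolding w_eq using m v w by (intro mixed_product[OF gI(1) minors]) (auto simp: w_eq)
        moreover have "mon m2 \<in> carrier (poly_ring vars)"
          using m by (intro mon_in_poly_ring) (simp add: m1 m2 keys_add_nat)
        ultimately have "var (i, a0, b0, c0) * var w * mon m2 \<in> I_J n lam l k r"
          by (rule poly_ideal_mult_right[OF gI(1)])
        then show ?thesis unfolding m1 m2 mon_vmon_add mult.assoc .
      next
        case True
        \<comment> \<open>The largest index in \<open>m\<close> belongs to the shortest block. The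
          component of that index keeps all variables of \<open>m\<close>, so the excess reaches
          that block size and the normal form at this block is 0.\<close>
        let ?A = "(\<lambda>(i, a, b, c). a) ` Poly_Mapping.keys m"
        have "Max ?A \<in> ?A" using v by (intro Max_in) auto
        then obtain v where "Max ?A = (\<lambda>(i, a, b, c). a) v" "v \<in> Poly_Mapping.keys m" by (rule imageE)
        with True obtain b c where v: "(i, Max ?A, b, c) \<in> Poly_Mapping.keys m" by (cases v) auto
        have "Poly_Mapping.keys m \<subseteq> upto_block i (Max ?A)"
        proof
          fix u assume u: "u \<in> Poly_Mapping.keys m"
          obtain i1 a1 b1 c1 where u_eq: "u = (i1, a1, b1, c1)" by (cases u)
          have "a1 \<in> ?A" using u u_eq by force
          then have "a1 \<le> Max ?A" by (intro Max_ge) simp_all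
          moreover have "i1 = i" using True u u_eq by force
          ultimately show "u \<in> upto_block i (Max ?A)" by (simp add: u_eq upto_block_def)
        qed
        moreover have "i \<in> {1..n}" "Max ?A \<in> {1..l i}"
          using subsetD[OF m v] by (simp_all add: in_all_vars Lam_iff)
        ultimately have "r i (Max ?A) \<le> excess m" by (intro Z)
        then have "tvar r (i, Max ?A, b, Suc (excess m)) \<in> I_J n lam l k r"
          by (simp add: tvar_def poly_ideal_0[OF gI(1)])
        then show ?thesis by (rule mon_zero[OF m True v])
      qed
    qed
  qed
qed

lemma irredundant: "irredundant_primary_decomposition (poly_ring vars) (I_J n lam l k r)
   (SIGMA i:{1..n}. {1..l i}) (\<lambda>(i, j). component n lam l k r i j)"
  unfolding irredundant_primary_decomposition_def
proof (intro conjI ballI)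
  let ?S = "SIGMA i:{1..n}. {1..l i}" and ?C = "\<lambda>(i, j). component n lam l k r i j"
  show "finite ?S" by (intro finite_SigmaI) simp_all
  have C: "?C s = Q vars (fst s) (snd s)" if "s \<in> ?S" for s
    using that by (auto simp: component_eq)
  show "primary_ideal (?C s) (poly_ring vars)" if "s \<in> ?S" for s
    unfolding C[OF that] using that by (intro primary_eps_ideal r_pos) auto
  show "I_J n lam l k r = carrier (poly_ring vars) \<inter> (\<Inter>s\<in>?S. ?C s)"
    unfolding I_J_eq using C by (intro arg_cong2[of _ _ _ _ "(\<inter>)"] INF_cong refl) (simp add: split_beta)
  have V: "(i, j, 1, c) \<in> vars" if "(i, j) \<in> ?S" "1 \<le> c" "c \<le> r i j" for i j c
    using that k_pos[of i j] by (simp add: in_all_vars Lam_iff)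
  show "\<not> carrier (poly_ring vars) \<inter> (\<Inter>u\<in>?S - {s}. ?C u) \<subseteq> ?C s" if s: "s \<in> ?S" for s
  proof -
    obtain i j where s_eq: "s = (i, j)" by (cases s)
    have ij: "i \<in> {1..n}" "j \<in> {1..l i}" using s by (auto simp: s_eq)
    have r: "1 \<le> r i j" by (rule r_pos[OF ij])
    \<comment> \<open>The offset \<open>r i j - 1\<close> is one short of lying in component
      \<open>(i, j)\<close> but at least \<open>r i j'\<close> for \<open>j' > j\<close>. For
      \<open>j' < j\<close> and for other eigenvalues the variable is sent to 0.\<close>
    let ?x = "(i, j, 1, r i j)"
    have x: "?x \<in> vars" using s r by (intro V) (simp_all add: s_eq)
    have Cs: "?C s = Q vars i j" using ij by (simp add: s_eq component_eq)
    have "(var ?x :: (idx, 'k) mpol) \<notin> ?C s"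
      unfolding Cs var_in_eps_ideal_iff[OF x]
      using r by (simp add: in_upto_block off_def)
    moreover have "var ?x \<in> ?C u" if u: "u \<in> ?S - {s}" for u
    proof -
      obtain i' j' where u_eq: "u = (i', j')" by (cases u)
      have "?x \<notin> upto_block i' j' \<or> r i' j' \<le> off ?x"
        using u ij r r_dec[of i j j'] by (cases "j' < j") (auto simp: u_eq s_eq in_upto_block off_def)
      moreover have "?C u = Q vars i' j'" using u by (simp add: u_eq component_eq)
      ultimately show ?thesis by (simp only: var_in_eps_ideal_iff[OF x] not_False_eq_True)
    qed
    ultimately show ?thesis using var_in_poly_ring[OF x] by blast
  qed
  show "inj_on (\<lambda>s. radical (poly_ring vars) (?C s)) ?S"
  proof (rule inj_onI)
    fix s u assume s: "s \<in> ?S" and u: "u \<in> ?S"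
      and eq: "radical (poly_ring vars) (?C s) = radical (poly_ring vars) (?C u)"
    obtain i j i' j' where s_eq: "s = (i, j)" and u_eq: "u = (i', j')" by (cases s, cases u)
    have rad: "radical (poly_ring vars) (?C s) = eps_ideal vars (upto_block (fst s) (snd s)) 1" if "s \<in> ?S" for s
      unfolding C[OF that] using that by (intro radical_eps_ideal r_pos) auto
    have x: "(i, j, 1, 1) \<in> vars" "(i', j', 1, 1) \<in> vars"
      using V[of i j 1] V[of i' j' 1] s u r_pos[of i j] r_pos[of i' j'] by (simp_all add: s_eq u_eq)
    \<comment> \<open>A variable of offset 0 lies in such a radical exactly when it is sent to 0, so
      testing the first variables of the two blocks recovers both indices.\<close>
    have "(var v :: (idx, 'k) mpol) \<in> eps_ideal vars (upto_block i j) 1 \<longleftrightarrow>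
        (var v :: (idx, 'k) mpol) \<in> eps_ideal vars (upto_block i' j') 1" for v
      using eq unfolding rad[OF s] rad[OF u] by (simp add: s_eq u_eq)
    from this[of "(i, j, 1, 1)"] this[of "(i', j', 1, 1)"]
    show "s = u"
      unfolding var_in_eps_ideal_iff[OF x(1)] var_in_eps_ideal_iff[OF x(2)]
      by (simp add: s_eq u_eq in_upto_block off_def)
  qed
qed

end

section \<open>Hilbert polynomials\<close>

lemma rcos_eq_iff:
  fixes p q :: "('v, 'k::field) mpol"
  assumes I: "ideal I (poly_ring V)" and "p \<in> carrier (poly_ring V)" "q \<in> carrier (poly_ring V)"
  shows "I +>\<^bsub>poly_ring V\<^esub> p = I +>\<^bsub>poly_ring V\<^esub> q \<longleftrightarrow> p - q \<in> I"
proof -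
  interpret ideal I "poly_ring V" by fact
  have "p \<ominus>\<^bsub>poly_ring V\<^esub> q = p - q"
  proof -
    have "\<ominus>\<^bsub>poly_ring V\<^esub> q = - q"
      using assms(3) by (intro minus_equality) (auto simp: poly_ring_closed)
    then show ?thesis by (simp add: a_minus_def)
  qed
  then show ?thesis using quotient_eq_iff_same_a_r_cos[OF I assms(2,3)] by simp
qed

text \<open>The span over the constants of the cosets of the monomials \<open>h s\<close>.
  Coefficients are functions of the index, so one of them can be changed by function update.\<close>

definition lincomb_cosets :: "'v set \<Rightarrow> ('v, 'k::field) mpol set \<Rightarrow> ('s \<Rightarrow> 'v \<Rightarrow>\<^sub>0 nat) \<Rightarrow> 's set \<Rightarrow> ('v, 'k) mpol set set" where
  "lincomb_cosets V I h S = range (\<lambda>c. I +>\<^bsub>poly_ring V\<^esub> (\<Sum>s\<in>S. Poly_Mapping.single (h s) (c s)))"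

lemma lincomb_in_poly_ring:
  assumes "\<And>s. s \<in> S \<Longrightarrow> Poly_Mapping.keys (h s) \<subseteq> V"
  shows "(\<Sum>s\<in>S. Poly_Mapping.single (h s) (c s)) \<in> carrier (poly_ring V)"
  using assms
proof (induction S rule: infinite_finite_induct)
  case (insert s S)
  have "Poly_Mapping.single (h s) (c s) \<in> carrier (poly_ring V)"
    using insert.prems by (auto simp: mem_poly_ring_iff)
  with insert show ?case by (simp add: poly_ring_closed)
qed (simp_all add: poly_ring_closed)

text \<open>Independence modulo \<open>I\<close> puts each new coset outside the span of the earlier
  ones, so every line extension raises the dimension by one.\<close>

lemma dimension_lincomb_cosets:
  fixes I :: "('v, 'k::field) mpol set" and h :: "'s \<Rightarrow> 'v \<Rightarrow>\<^sub>0 nat"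
  assumes I: "ideal I (poly_ring V)" and "finite S"
    and "\<And>s. s \<in> S \<Longrightarrow> Poly_Mapping.keys (h s) \<subseteq> V"
    and "\<And>c s. (\<Sum>s\<in>S. Poly_Mapping.single (h s) (c s)) \<in> I \<Longrightarrow> s \<in> S \<Longrightarrow> c s = 0"
  shows "ring.dimension (poly_ring V Quot I) (card S) (quot_scalars V I) (lincomb_cosets V I h S)"
  using assms(2-)
proof (induction S rule: finite_induct)
  case empty
  interpret ideal I "poly_ring V" by fact
  interpret Q: ring "poly_ring V Quot I" by (rule quotient_is_ring)
  have "\<zero>\<^bsub>poly_ring V Quot I\<^esub> = I +>\<^bsub>poly_ring V\<^esub> 0"
    using ring_hom_zero[OF rcos_ring_hom ring_axioms Q.ring_axioms] by simp
  then have "lincomb_cosets V I h {} = {\<zero>\<^bsub>poly_ring V Quot I\<^esub>}"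
    by (auto simp: lincomb_cosets_def)
  then show ?case using Q.zero_dim by simp
next
  case (insert x F)
  interpret ideal I "poly_ring V" by fact
  interpret Q: ring "poly_ring V Quot I" by (rule quotient_is_ring)
  let ?cos = "\<lambda>p. I +>\<^bsub>poly_ring V\<^esub> p"
  let ?L = "\<lambda>c. \<Sum>s\<in>F. Poly_Mapping.single (h s) (c s) :: ('v, 'k) mpol"
  have sum_insert: "(\<Sum>s\<in>insert x F. Poly_Mapping.single (h s) (c s)) = const (c x) * mon (h x) + ?L c" for c
    using insert.hyps by (simp add: const_def mult_single)
  have upd: "?L (c(x := k)) = ?L c" for c k
    using insert.hyps by (intro sum.cong) auto
  have L: "?L c \<in> carrier (poly_ring V)" for c
    using insert.prems(1) by (intro lincomb_in_poly_ring) simp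
  have x: "mon (h x) \<in> carrier (poly_ring V)"
    using insert.prems(1) by (intro mon_in_poly_ring) simp
  have IH: "Q.dimension (card F) (quot_scalars V I) (lincomb_cosets V I h F)"
  proof (rule insert.IH)
    show "c s = 0" if "?L c \<in> I" "s \<in> F" for c s
    proof -
      \<comment> \<open>A relation over \<open>F\<close> is a relation over
        \<open>insert x F\<close> with coefficient 0 at \<open>x\<close>.\<close>
      have "(\<Sum>s\<in>insert x F. Poly_Mapping.single (h s) ((c(x := 0)) s)) \<in> I"
        unfolding sum_insert upd using that(1) by simp
      from insert.prems(2)[OF this, of s] show ?thesis using that(2) insert.hyps(2) by (cases "s = x") simp_all
    qed
  qed (use insert.prems in auto)
  have notin: "?cos (mon (h x)) \<notin> lincomb_cosets V I h F"
  proof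
    assume "?cos (mon (h x)) \<in> lincomb_cosets V I h F"
    then obtain c where "?cos (mon (h x)) = ?cos (?L c)" by (auto simp: lincomb_cosets_def)
    then have "mon (h x) - ?L c \<in> I" using rcos_eq_iff[OF I x L] by simp
    \<comment> \<open>As a relation over \<open>insert x F\<close> this has coefficient 1 at
      \<open>x\<close>, against independence.\<close>
    moreover have "(\<Sum>s\<in>insert x F. Poly_Mapping.single (h s) (((\<lambda>s. - c s)(x := 1)) s)) = mon (h x) - ?L c"
      unfolding sum_insert upd by (simp add: const_def single_uminus sum_negf)
    ultimately have "(\<Sum>s\<in>insert x F. Poly_Mapping.single (h s) (((\<lambda>s. - c s)(x := 1)) s)) \<in> I" by (simp only:)
    from insert.prems(2)[OF this insertI1] show False by simp
  qed
  have ops: "?cos (const k) \<otimes>\<^bsub>poly_ring V Quot I\<^esub> ?cos (mon (h x)) \<oplus>\<^bsub>poly_ring V Quot I\<^esub> ?cos (?L c)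
      = ?cos (const k * mon (h x) + ?L c)" for k c
    using ring_hom_mult[OF rcos_ring_hom const_in_poly_ring x, of k]
      ring_hom_add[OF rcos_ring_hom poly_ring_closed(4)[OF const_in_poly_ring x] L, of k c] by simp
  have "Q.line_extension (quot_scalars V I) (?cos (mon (h x))) (lincomb_cosets V I h F) =
      lincomb_cosets V I h (insert x F)"
  proof (intro equalityI subsetI)
    fix u assume "u \<in> Q.line_extension (quot_scalars V I) (?cos (mon (h x))) (lincomb_cosets V I h F)"
    then obtain k c where "u = ?cos (const k * mon (h x) + ?L c)"
      unfolding Q.line_extension_mem_iff by (auto simp: quot_scalars_def lincomb_cosets_def ops)
    then have "u = ?cos (\<Sum>s\<in>insert x F. Poly_Mapping.single (h s) ((c(x := k)) s))"
      unfolding sum_insert upd by simp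
    then show "u \<in> lincomb_cosets V I h (insert x F)" unfolding lincomb_cosets_def by blast
  next
    fix u assume "u \<in> lincomb_cosets V I h (insert x F)"
    then obtain c where "u = ?cos (const (c x) * mon (h x) + ?L c)"
      unfolding lincomb_cosets_def sum_insert by blast
    then show "u \<in> Q.line_extension (quot_scalars V I) (?cos (mon (h x))) (lincomb_cosets V I h F)"
      unfolding Q.line_extension_mem_iff ops[symmetric] quot_scalars_def lincomb_cosets_def by blast
  qed
  moreover have "?cos (mon (h x)) \<in> carrier (poly_ring V Quot I)"
    using ring_hom_closed[OF rcos_ring_hom x] .
  ultimately show ?case
    using Q.Suc_dim[OF _ notin IH] insert.hyps by simp
qed

text \<open>Each monomial of degree \<open>t\<close> is congruent to 0 or to a representative;
  induction over the terms extends this to homogeneous polynomials.\<close>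

lemma quot_part_eq_lincomb_cosets:
  fixes I :: "('v, 'k::field) mpol set" and h :: "'s \<Rightarrow> 'v \<Rightarrow>\<^sub>0 nat"
  assumes I: "ideal I (poly_ring V)" and S: "finite S"
    and h: "\<And>s. s \<in> S \<Longrightarrow> Poly_Mapping.keys (h s) \<subseteq> V" "\<And>s. s \<in> S \<Longrightarrow> mdeg (h s) = t"
    and span: "\<And>m. Poly_Mapping.keys m \<subseteq> V \<Longrightarrow> mdeg m = t \<Longrightarrow> mon m \<in> I \<or> (\<exists>s\<in>S. mon m - mon (h s) \<in> I)"
  shows "quot_part V I t = lincomb_cosets V I h S"
proof (intro equalityI subsetI)
  let ?L = "\<lambda>c. \<Sum>s\<in>S. Poly_Mapping.single (h s) (c s) :: ('v, 'k) mpol"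
  have L: "?L c \<in> carrier (poly_ring V)" for c using h(1) by (rule lincomb_in_poly_ring)
  {
    fix x assume "x \<in> lincomb_cosets V I h S"
    then obtain c where x: "x = I +>\<^bsub>poly_ring V\<^esub> ?L c" by (auto simp: lincomb_cosets_def)
    have "mdeg m = t" if m: "m \<in> Poly_Mapping.keys (?L c)" for m
    proof -
      have "m \<in> (\<Union>s\<in>S. Poly_Mapping.keys (Poly_Mapping.single (h s) (c s)))"
        by (rule subsetD[OF keys_sum m])
      then obtain s where "s \<in> S" "m = h s" by (auto split: if_splits)
      then show ?thesis using h(2) by simp
    qed
    then show "x \<in> quot_part V I t"
      using L by (auto simp: x quot_part_def homogeneous_part_def)
  next
    fix x assume "x \<in> quot_part V I t"
    then obtain p where x: "x = I +>\<^bsub>poly_ring V\<^esub> p" and p: "p \<in> carrier (poly_ring V)"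
      and deg: "\<And>m. m \<in> Poly_Mapping.keys p \<Longrightarrow> mdeg m = t"
      by (auto simp: quot_part_def homogeneous_part_def)
    have single: "\<exists>c. Poly_Mapping.single m k - ?L c \<in> I" if "Poly_Mapping.keys m \<subseteq> V" "mdeg m = t" for m k
      using span[OF that]
    proof
      assume "mon m \<in> I"
      from poly_ideal_mult[OF I this const_in_poly_ring[of k]]
      have "Poly_Mapping.single m k - ?L (\<lambda>_. 0) \<in> I" by (simp add: const_def mult_single)
      then show ?thesis by (intro exI[of _ "\<lambda>_. 0"])
    next
      assume "\<exists>s\<in>S. mon m - mon (h s) \<in> I"
      then obtain s where s: "s \<in> S" "mon m - mon (h s) \<in> I" by blast
      have "?L (\<lambda>u. if u = s then k else 0) = (\<Sum>u\<in>S. if u = s then Poly_Mapping.single (h s) k else 0)"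
        by (intro sum.cong) auto
      also have "\<dots> = Poly_Mapping.single (h s) k" using S s(1) by simp
      finally have "Poly_Mapping.single m k - ?L (\<lambda>u. if u = s then k else 0) = const k * (mon m - mon (h s))"
        by (simp add: const_def mult_single right_diff_distrib)
      then have "Poly_Mapping.single m k - ?L (\<lambda>u. if u = s then k else 0) \<in> I"
        using poly_ideal_mult[OF I s(2) const_in_poly_ring] by (rule ssubst)
      then show ?thesis by (intro exI[of _ "\<lambda>u. if u = s then k else 0"])
    qed
    have "\<exists>c. (\<Sum>m\<in>M. Poly_Mapping.single m (Poly_Mapping.lookup p m)) - ?L c \<in> I"
      if "finite M" "M \<subseteq> Poly_Mapping.keys p" for M
      using that
    proof (induction M rule: finite_induct)
      case empty
      have "(\<Sum>m\<in>{}. Poly_Mapping.single m (Poly_Mapping.lookup p m)) - ?L (\<lambda>_. 0) \<in> I"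
        using poly_ideal_0[OF I] by simp
      then show ?case by (intro exI[of _ "\<lambda>_. 0"])
    next
      case (insert m M)
      then obtain c where c: "(\<Sum>m\<in>M. Poly_Mapping.single m (Poly_Mapping.lookup p m)) - ?L c \<in> I" by auto
      have "Poly_Mapping.keys m \<subseteq> V" "mdeg m = t"
        using insert.prems p deg by (auto simp: mem_poly_ring_iff)
      from single[OF this] obtain c' where
        c': "Poly_Mapping.single m (Poly_Mapping.lookup p m) - ?L c' \<in> I" by blast
      have "?L (\<lambda>s. c' s + c s) = ?L c' + ?L c" by (simp add: single_add sum.distrib)
      then have "(\<Sum>m\<in>insert m M. Poly_Mapping.single m (Poly_Mapping.lookup p m)) - ?L (\<lambda>s. c' s + c s) =
          (Poly_Mapping.single m (Poly_Mapping.lookup p m) - ?L c') +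
          ((\<Sum>m\<in>M. Poly_Mapping.single m (Poly_Mapping.lookup p m)) - ?L c)"
        using insert.hyps by simp
      then have "(\<Sum>m\<in>insert m M. Poly_Mapping.single m (Poly_Mapping.lookup p m)) - ?L (\<lambda>s. c' s + c s) \<in> I"
        using poly_ideal_add[OF I c' c] by (rule ssubst)
      then show ?case by (intro exI[of _ "\<lambda>s. c' s + c s"])
    qed
    from this[OF finite_keys order_refl] obtain c where "p - ?L c \<in> I"
      unfolding sum_singles_keys by blast
    then have "I +>\<^bsub>poly_ring V\<^esub> p = I +>\<^bsub>poly_ring V\<^esub> ?L c"
      using rcos_eq_iff[OF I p L] by simp
    then show "x \<in> lincomb_cosets V I h S" by (auto simp: x lincomb_cosets_def)
  }
qed

text \<open>Exponent vectors correspond to multisets of variables, with the degree as size.\<close>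

lemma card_monomials_of_degree:
  assumes "finite B"
  shows "finite {s :: 'v \<Rightarrow>\<^sub>0 nat. Poly_Mapping.keys s \<subseteq> B \<and> mdeg s = t}"
    and "card {s :: 'v \<Rightarrow>\<^sub>0 nat. Poly_Mapping.keys s \<subseteq> B \<and> mdeg s = t} = (card B + t - 1) choose t"
proof -
  let ?A = "{s :: 'v \<Rightarrow>\<^sub>0 nat. Poly_Mapping.keys s \<subseteq> B \<and> mdeg s = t}"
  define g :: "'v multiset \<Rightarrow> 'v \<Rightarrow>\<^sub>0 nat" where "g X = (\<Sum>x\<in>#X. vmon x)" for X
  have lookup: "Poly_Mapping.lookup (g X) v = count X v" for X v
    by (induction X) (auto simp: g_def lookup_add lookup_single when_def)
  have keys: "Poly_Mapping.keys (g X) = set_mset X" for X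
    by (auto simp: in_keys_iff lookup)
  have deg: "mdeg (g X) = size X" for X
    by (induction X) (simp_all add: g_def)
  have ex: "\<exists>X. g X = s" for s
  proof (induction s rule: monomial_induct)
    case zero
    have "g {#} = 0" by (simp add: g_def)
    then show ?case ..
  next
    case (add v s)
    then obtain X where "g X = s" ..
    then have "g (add_mset v X) = vmon v + s" by (simp add: g_def)
    then show ?case ..
  qed
  have "?A = g ` multisets_of_size B t"
  proof (intro equalityI subsetI)
    fix s assume s: "s \<in> ?A"
    obtain X where "g X = s" using ex by blast
    with s show "s \<in> g ` multisets_of_size B t"
      by (intro image_eqI[of _ _ X]) (auto simp: multisets_of_size_def keys deg)
  qed (auto simp: multisets_of_size_def keys deg)
  moreover have "inj g"
    by (rule injI, rule multiset_eqI) (simp flip: lookup)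
  ultimately have "bij_betw g (multisets_of_size B t) ?A"
    by (simp add: bij_betw_def inj_on_subset[OF \<open>inj g\<close>])
  note bij = this
  show "finite ?A"
    using bij_betw_finite[OF bij] finite_multisets_of_size[OF assms, of t] by simp
  show "card ?A = (card B + t - 1) choose t"
    using bij_betw_same_card[OF bij] card_multisets_of_size[OF assms, of t] by simp
qed

lemma mon_in_eps_ideal:
  assumes "Poly_Mapping.keys m \<subseteq> V" "\<not> (Poly_Mapping.keys m \<subseteq> U \<and> excess m < e)"
  shows "mon m \<in> eps_ideal V U e"
  using assms by (auto simp: eps_ideal_def eps_map_single mon_in_poly_ring monom_1_dvd_iff')

text \<open>The whole excess goes on one variable, supplied by \<open>s \<noteq> 0\<close>; there is
  room because every block up to \<open>j\<close> is longer than \<open>e\<close>.\<close>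

lemma exists_monomial_with_shape:
  assumes "s \<noteq> 0" "Poly_Mapping.keys s \<subseteq> {(i, a, b, 1) | a b. a \<in> {1..j} \<and> b \<in> {1..k i a}}"
    and "\<And>a. a \<in> {1..j} \<Longrightarrow> e < r i a" "j \<le> l i"
  shows "\<exists>m. Poly_Mapping.keys m \<subseteq> Lam l k r i \<inter> upto_block i j \<and> shape m = s \<and> excess m = e"
proof -
  let ?B = "{(i, a, b, 1) | a b. a \<in> {1..j} \<and> b \<in> {1..k i a}} :: idx set"
  have shape_id: "shape m = m \<and> excess m = 0" if "Poly_Mapping.keys m \<subseteq> ?B" for m
    using that
  proof (induction m rule: monomial_induct)
    case (add v m)
    then have "v \<in> ?B" "Poly_Mapping.keys m \<subseteq> ?B" by (auto simp: keys_add_nat)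
    then have "base v = v" "off v = 0" by (auto simp: base_def off_def)
    then show ?case using add.IH[OF \<open>Poly_Mapping.keys m \<subseteq> ?B\<close>] unfolding shape_add excess_add shape_vmon excess_vmon by simp
  qed simp
  have B: "?B \<subseteq> Lam l k r i \<inter> upto_block i j"
  proof
    fix v assume "v \<in> ?B"
    then obtain a b where v: "v = (i, a, b, 1)" "a \<in> {1..j}" "b \<in> {1..k i a}" by blast
    with assms(3)[of a] assms(4) show "v \<in> Lam l k r i \<inter> upto_block i j"
      by (simp add: Lam_iff in_upto_block)
  qed
  from assms(1) obtain v where v: "v \<in> Poly_Mapping.keys s" by (rule nonzero_obtain_key)
  then obtain m where s: "s = vmon v + m" by (rule remove_vmon)
  have m: "Poly_Mapping.keys m \<subseteq> ?B" using assms(2) by (simp add: s keys_add_nat)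
  obtain a b where v_eq: "v = (i, a, b, 1)" and ab: "a \<in> {1..j}" "b \<in> {1..k i a}"
    using subsetD[OF assms(2) v] by blast
  \<comment> \<open>Moving one first variable to position \<open>Suc e\<close> adds \<open>e\<close>
    to the excess and keeps the shape.\<close>
  let ?m = "vmon (i, a, b, Suc e) + m"
  have "(i, a, b, Suc e) \<in> Lam l k r i \<inter> upto_block i j"
    using ab assms(3)[of a] assms(4) by (simp add: Lam_iff in_upto_block)
  then have "Poly_Mapping.keys ?m \<subseteq> Lam l k r i \<inter> upto_block i j"
    using order_trans[OF m B] by (simp add: keys_add_nat)
  moreover have "shape ?m = s" "excess ?m = e"
    using shape_id[OF m] unfolding shape_add excess_add shape_vmon excess_vmon
    by (simp_all add: s v_eq base_def off_def)
  ultimately show ?thesis by blast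
qed

section \<open>Hilbert functions of the components\<close>

context jordan_data
begin

text \<open>One monomial for each shape of degree \<open>t\<close> and each excess below
  \<open>r i j\<close> gives a basis of the graded piece. Variables of other eigenvalues are sent to
  0, so both rings give the same count.\<close>

lemma has_hilbert_polynomial_Q:
  assumes i: "i \<in> {1..n}" "j \<in> {1..l i}" and V: "V = block_vars i \<or> V = vars"
  shows "has_hilbert_polynomial V (Q V i j) (smult (of_nat (r i j)) (binom_poly (\<Sum>a=1..j. k i a)))"
proof -
  \<comment> \<open>\<open>?B\<close> represents the variables u_ab with
    \<open>a \<le> j\<close>.\<close>
  let ?B = "{(i, a, b, 1) | a b. a \<in> {1..j} \<and> b \<in> {1..k i a}} :: idx set"
  let ?K = "\<Sum>a=1..j. k i a"
  let ?I = "Q V i j"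
  have B_image: "?B = (\<lambda>(a, b). (i, a, b, 1)) ` (SIGMA a:{1..j}. {1..k i a})" by auto
  have fin_B: "finite ?B" unfolding B_image by (intro finite_imageI finite_SigmaI) simp_all
  have "card ?B = card (SIGMA a:{1..j}. {1..k i a})"
    unfolding B_image by (intro card_image inj_onI) auto
  then have card_B: "card ?B = ?K" by simp
  have "k i 1 \<le> ?K" using i by (intro member_le_sum) simp_all
  moreover have "1 \<le> k i 1" using i by (intro k_pos) simp_all
  ultimately have K: "?K \<ge> 1" by linarith
  have block: "block_vars i \<subseteq> V" using V block_vars_subset[OF i(1)] by blast
  have V_block: "V \<inter> upto_block i j \<subseteq> block_vars i"
    using V by (auto simp: upto_block_def in_all_vars)
  have I: "ideal ?I (poly_ring V)" by (rule eps_ideal_ideal)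
  \<comment> \<open>In degree 0 only excess 0 occurs, while the polynomial takes the value
    \<open>r i j\<close>; hence the bound \<open>t \<ge> 1\<close>.\<close>
  have "\<exists>d. ring.dimension (poly_ring V Quot ?I) d (quot_scalars V ?I) (quot_part V ?I t) \<and>
      poly (smult (of_nat (r i j)) (binom_poly ?K)) (of_nat t) = of_nat d" if t: "t \<ge> 1" for t
  proof -
    let ?S = "{s. Poly_Mapping.keys s \<subseteq> ?B \<and> mdeg s = t} \<times> {..<r i j}"
    have fin_S: "finite ?S"
      using card_monomials_of_degree(1)[OF fin_B] by simp
    have card_S: "card ?S = ((?K + t - 1) choose t) * r i j"
      using card_monomials_of_degree(2)[OF fin_B] card_B by (simp add: card_cartesian_product)
    have "\<forall>s\<in>?S. \<exists>m. Poly_Mapping.keys m \<subseteq> block_vars i \<inter> upto_block i j \<and>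
        shape m = fst s \<and> excess m = snd s"
    proof (rule ballI, rule exists_monomial_with_shape)
      fix s assume s: "s \<in> ?S"
      show "fst s \<noteq> 0" "Poly_Mapping.keys (fst s) \<subseteq> ?B" "j \<le> l i" using s t i by auto
      show "snd s < r i a" if "a \<in> {1..j}" for a
        using \<open>s \<in> ?S\<close> r_antimono[OF i(1), of a j] that i by auto
    qed
    from bchoice[OF this] obtain h where "\<forall>s\<in>?S. Poly_Mapping.keys (h s) \<subseteq> block_vars i \<inter> upto_block i j \<and>
        shape (h s) = fst s \<and> excess (h s) = snd s" ..
    then have h: "Poly_Mapping.keys (h s) \<subseteq> block_vars i \<inter> upto_block i j"
      "shape (h s) = fst s" "excess (h s) = snd s" if "s \<in> ?S" for s
      using that by blast+
    have hV: "Poly_Mapping.keys (h s) \<subseteq> V" if "s \<in> ?S" for s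
      using h(1)[OF that] block by blast
    have h_deg: "mdeg (h s) = t" if "s \<in> ?S" for s
      using h(2)[OF that] that mdeg_shape[of "h s"] by auto
    have span: "mon m \<in> ?I \<or> (\<exists>s\<in>?S. mon m - mon (h s) \<in> ?I)"
      if m: "Poly_Mapping.keys m \<subseteq> V" "mdeg m = t" for m
    proof (cases "Poly_Mapping.keys m \<subseteq> upto_block i j \<and> excess m < r i j")
      case True
      have "base v \<in> ?B" if v: "v \<in> Poly_Mapping.keys m" for v
      proof -
        obtain i' a b c where v_eq: "v = (i', a, b, c)" by (cases v)
        have "v \<in> block_vars i" "v \<in> upto_block i j" using V_block True m(1) v by blast+
        then show ?thesis by (simp add: v_eq base_def Lam_iff in_upto_block)
      qed
      then have s: "(shape m, excess m) \<in> ?S"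
        using True m(2) by (auto simp: keys_shape)
      \<comment> \<open>Equal shape and excess give equal images, so the difference is mapped to
        0.\<close>
      have "eps_map (upto_block i j) (mon m - mon (h (shape m, excess m))) = (0 :: (idx, 'k) mpol poly)"
        using True h[OF s] by (simp add: eps_map_diff eps_map_single)
      moreover have "(mon m - mon (h (shape m, excess m)) :: (idx, 'k) mpol) \<in> carrier (poly_ring V)"
        using m(1) hV[OF s] by (intro poly_ring_closed mon_in_poly_ring)
      ultimately have "mon m - mon (h (shape m, excess m)) \<in> ?I" by (simp add: eps_ideal_def)
      with s show ?thesis by blast
    next
      case False
      then show ?thesis using mon_in_eps_ideal[OF m(1)] by blast
    qed
    have indep: "c u = 0" if c: "(\<Sum>s\<in>?S. Poly_Mapping.single (h s) (c s)) \<in> ?I" and u: "u \<in> ?S" for c u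
    proof -
      have "eps_map (upto_block i j) (\<Sum>s\<in>?S. Poly_Mapping.single (h s) (c s)) =
          (\<Sum>s\<in>?S. monom (Poly_Mapping.single (fst s) (c s)) (snd s))"
        unfolding eps_map_sum
      proof (intro sum.cong refl)
        fix s assume s: "s \<in> ?S"
        from h[OF s] show "eps_map (upto_block i j) (Poly_Mapping.single (h s) (c s)) =
            monom (Poly_Mapping.single (fst s) (c s)) (snd s)"
          by (simp add: eps_map_single)
      qed
      moreover have "snd u < r i j" using u by auto
      \<comment> \<open>The images of the \<open>h s\<close> are distinct monomials, so this
        coefficient isolates \<open>c u\<close>; it vanishes because
        \<open>snd u < r i j\<close>.\<close>
      ultimately have "coeff (\<Sum>s\<in>?S. monom (Poly_Mapping.single (fst s) (c s)) (snd s)) (snd u) = 0"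
        using c by (simp add: eps_ideal_def monom_1_dvd_iff')
      then have "0 = Poly_Mapping.lookup (coeff (\<Sum>s\<in>?S. monom (Poly_Mapping.single (fst s) (c s)) (snd s)) (snd u)) (fst u)"
        by simp
      also have "\<dots> = (\<Sum>s\<in>?S. if s = u then c s else 0)"
        unfolding coeff_sum lookup_sum
        by (intro sum.cong refl) (auto simp: lookup_single when_def prod_eq_iff)
      also have "\<dots> = c u" using u fin_S by simp
      finally show ?thesis by simp
    qed
    have quot_part: "quot_part V ?I t = lincomb_cosets V ?I h ?S"
    proof (rule quot_part_eq_lincomb_cosets[OF I fin_S])
      show "Poly_Mapping.keys (h s) \<subseteq> V" if "s \<in> ?S" for s by (rule hV[OF that])
      show "mdeg (h s) = t" if "s \<in> ?S" for s by (rule h_deg[OF that])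
      show "mon m \<in> ?I \<or> (\<exists>s\<in>?S. mon m - mon (h s) \<in> ?I)"
        if "Poly_Mapping.keys m \<subseteq> V" "mdeg m = t" for m by (rule span[OF that])
    qed
    have "ring.dimension (poly_ring V Quot ?I) (card ?S) (quot_scalars V ?I) (quot_part V ?I t)"
      unfolding quot_part
    proof (rule dimension_lincomb_cosets[OF I fin_S])
      show "Poly_Mapping.keys (h s) \<subseteq> V" if "s \<in> ?S" for s by (rule hV[OF that])
      show "c s = 0" if "(\<Sum>s\<in>?S. Poly_Mapping.single (h s) (c s)) \<in> ?I" "s \<in> ?S" for c s
        by (rule indep[OF that])
    qed
    moreover have "poly (smult (of_nat (r i j)) (binom_poly ?K)) (of_nat t) = of_nat (card ?S)"
      unfolding card_S using poly_binom_poly[OF K, of t] by (simp add: add.commute)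
    ultimately show ?thesis by blast
  qed
  then show ?thesis unfolding has_hilbert_polynomial_def by blast
qed

end

theorem corollary4p8:
  fixes n :: nat
    and lam :: "nat \<Rightarrow> 'k::field"
    and l :: "nat \<Rightarrow> nat"
    and k r :: "nat \<Rightarrow> nat \<Rightarrow> nat"
  assumes "n \<ge> 1"
    and "inj_on lam {1..n}"
    and "\<And>i. i \<in> {1..n} \<Longrightarrow> l i \<ge> 1"
    and "\<And>i j. i \<in> {1..n} \<Longrightarrow> j \<in> {1..l i} \<Longrightarrow> k i j \<ge> 1"
    and "\<And>i j. i \<in> {1..n} \<Longrightarrow> j \<in> {1..l i} \<Longrightarrow> r i j \<ge> 1"
    and "\<And>i j j'. i \<in> {1..n} \<Longrightarrow> j \<in> {1..l i} \<Longrightarrow> j' \<in> {1..l i} \<Longrightarrow> j < j' \<Longrightarrow> r i j > r i j'"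
  shows "irredundant_primary_decomposition (poly_ring (all_vars n l k r)) (I_J n lam l k r)
           (SIGMA i:{1..n}. {1..l i}) (\<lambda>(i, j). component n lam l k r i j) \<and>
         (\<forall>i\<in>{1..n}. \<forall>j\<in>{1..l i}.
           let H = smult (of_nat (r i j)) (binom_poly (\<Sum>a=1..j. k i a))
           in has_hilbert_polynomial (all_vars n l k r) (component n lam l k r i j) H \<and>
              has_hilbert_polynomial (Lam l k r i) (q_ideal lam l k r i j) H)"
proof -
  interpret jordan_data n lam l k r
    by (rule jordan_data.intro) (fact assms)+
  show ?thesis
    unfolding Let_def using irredundant has_hilbert_polynomial_Q
    by (simp add: component_eq q_ideal_eq)
qed

end
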